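(* Let $F=K(x,y)$ be the Kummer extension defined by $y^m=f(x)^{\lambda}$, where $f(x)\in\mathbb{F}_q[x]$ is a separable polynomial of degree $r$ and $\gcd(m,r\lambda)=1$. Let $P\neq P_\infty$ be a place of $F$ that is totally ramified in $F/K(x)$. Then $$\Gamma(P_\infty,P)=\left\{(mr-mj-ri,\ i+m(j-1)) \;\middle|\; i,j\in\mathbb{Z},\ 1\le i\le m-1-\lfloor m/r\rfloor,\ 1\le j\le r-1-\lfloor ri/m\rfloor\right\}.$$
   Context: $\mathbb{F}_q$ is a finite field of characteristic $p$ and $K$ is its algebraic closure. A Kummer extension here means the algebraic function field $F=K(x,y)$ over $K$ (with $x$ transcendental over $K$) defined by $y^m=f(x)^{\lambda}=\prod_{i=1}^r (x-\alpha_i)^\lambda$, where $m\ge 2$, $p\nmid m$, $\lambda$ is a positive integer, $f(x)\in\mathbb{F}_q[x]$, the elements $\alpha_1,\dots,\alpha_r\in K$ are pairwise distinct, and $\gcd(m,r\lambda)=1$. The places $Q_1,\dots,Q_r$ of $K(x)$ corresponding to the zeros $\alpha_1,\dots,\alpha_r$ of $f$ and the pole $Q_\infty$ of $x$ in $K(x)$ are totally ramified in $F/K(x)$; $P_i$ denotes the unique place of $F$ over $Q_i$, for $i=1,\dots,r,\infty$. Let $\mathbb{N}_0$ be the set of non-negative integers and $(z)_\infty$ the pole divisor of $z\in F$. For a place $R$ of $F$, $H(R)=\{n\in\mathbb{N}_0\mid (z)_\infty=nR\text{ for some }z\in F\}$ and $G(R)=\mathbb{N}_0\setminus H(R)$ is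 the set of gaps at $R$. For distinct places $R_1,R_2$ of $F$, $H(R_1,R_2)=\{(n_1,n_2)\in\mathbb{N}_0^2\mid (z)_\infty=n_1R_1+n_2R_2\text{ for some }z\in F\}$. For $\beta\in G(R_1)$ put $n_\beta=\min\{\gamma\in\mathbb{N}_0\mid (\beta,\gamma)\in H(R_1,R_2)\}$. It is known that $\beta\mapsto n_\beta$ is a bijection from $G(R_1)$ onto $G(R_2)$; its graph is denoted $\Gamma(R_1,R_2)=\{(\beta,n_\beta)\mid \beta\in G(R_1)\}$. *)

theory Defs
  imports
    "HOL-Algebra.Algebraic_Closure_Type"
    "HOL-Algebra.Finite_Extensions"
    "HOL-Algebra.Generated_Fields"
begin

text \<open>
  Conventions follow Stichtenoth, Algebraic Function Fields and Codes. All fields under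
  consideration are subsets of one field type: \<open>K\<close> is the field of constants and \<open>E\<close> a function
  field over \<open>K\<close>, with \<open>E = UNIV\<close> for the top field \<open>F\<close>. Both \<open>F\<close> and the intermediate field
  \<open>K(x)\<close> have places, hence the parameter \<open>E\<close>.
\<close>

abbreviation ambient :: "'f::field ring" where
  "ambient \<equiv> ring_of_type_algebra"

definition valuation_ring :: "'f::field set \<Rightarrow> 'f set \<Rightarrow> 'f set \<Rightarrow> bool" where
  "valuation_ring K E V \<longleftrightarrow>
     subring V ambient \<and> K \<subset> V \<and> V \<subset> E \<and> (\<forall>z\<in>E. z \<in> V \<or> inverse z \<in> V)"

text \<open>A place is the maximal ideal (the set of non-units) of a valuation ring.\<close>

definition place :: "'f::field set \<Rightarrow> 'f set \<Rightarrow> 'f set \<Rightarrow> bool" where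
  "place K E P \<longleftrightarrow> (\<exists>V. valuation_ring K E V \<and> P = {z \<in> V. \<not> (z \<noteq> 0 \<and> inverse z \<in> V)})"

text \<open>
  The valuation ring is recovered from its maximal ideal; \<open>0\<close> is listed separately
  because \<open>inverse 0 = 0\<close> lies in \<open>P\<close>.
\<close>

definition ring_of_place :: "'f::field set \<Rightarrow> 'f set \<Rightarrow> 'f set" where
  "ring_of_place E P = {z \<in> E. z = 0 \<or> inverse z \<notin> P}"

definition prime_element :: "'f::field set \<Rightarrow> 'f set \<Rightarrow> 'f \<Rightarrow> bool" where
  "prime_element E P t \<longleftrightarrow> P = (\<lambda>a. t * a) ` ring_of_place E P"

text \<open>
  The normalized discrete valuation: \<open>z = t\<^sup>n u\<close> with \<open>t\<close> a prime element and \<open>u\<close> a unit.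
  It is meaningful only for nonzero \<open>z \<in> E\<close>; the value \<open>\<infinity>\<close> at \<open>0\<close> is not modelled.
\<close>

definition val :: "'f::field set \<Rightarrow> 'f set \<Rightarrow> 'f \<Rightarrow> int" where
  "val E P z = (THE n. \<exists>t u. prime_element E P t \<and> u \<in> ring_of_place E P - P \<and> z = t powi n * u)"

text \<open>For a place \<open>P\<close> of the top field and a place \<open>Q\<close> of a subfield (\<open>P\<close> lies over \<open>Q\<close>).\<close>

definition lies_over :: "'f::field set \<Rightarrow> 'f set \<Rightarrow> bool" where
  "lies_over P Q \<longleftrightarrow> Q \<subseteq> P"

definition ramification_index :: "'f::field set \<Rightarrow> 'f set \<Rightarrow> 'f set \<Rightarrow> nat" where
  "ramification_index E P Q =
     (THE e. e \<ge> 1 \<and> (\<forall>z\<in>E. z \<noteq> 0 \<longrightarrow> val UNIV P z = int e * val E Q z))"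

text \<open>
  \<open>P\<close> is the only place over its restriction \<open>Q\<close> to \<open>E\<close>, and \<open>e(P|Q) = [F:E]\<close>.
\<close>

definition totally_ramified :: "'f::field set \<Rightarrow> 'f set \<Rightarrow> 'f set \<Rightarrow> bool" where
  "totally_ramified K E P \<longleftrightarrow>
     (\<exists>Q. place K E Q \<and> lies_over P Q \<and>
          (\<forall>P'. place K UNIV P' \<and> lies_over P' Q \<longrightarrow> P' = P) \<and>
          ring.dimension ambient (ramification_index E P Q) E UNIV)"

text \<open>
  Divisors of the top field are integer-valued functions on sets, zero off the places.
  The divisor of poles of a nonzero \<open>z\<close> automatically has finite support.
\<close>

definition place_divisor :: "nat \<Rightarrow> 'f::field set \<Rightarrow> 'f set \<Rightarrow> int" where
  "place_divisor n R = (\<lambda>P. if P = R then int n else 0)"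

definition pole_divisor :: "'f::field set \<Rightarrow> 'f \<Rightarrow> 'f set \<Rightarrow> int" where
  "pole_divisor K z = (\<lambda>P. if place K UNIV P \<and> val UNIV P z < 0 then - val UNIV P z else 0)"

text \<open>
  In the two semigroups \<open>z = 0\<close>, which has no divisor, is excluded; \<open>0\<close> and \<open>(0,0)\<close> come from
  the constants.
\<close>

definition weierstrass_semigroup :: "'f::field set \<Rightarrow> 'f set \<Rightarrow> nat set" where
  "weierstrass_semigroup K R = {n. \<exists>z. z \<noteq> 0 \<and> pole_divisor K z = place_divisor n R}"

definition gaps :: "'f::field set \<Rightarrow> 'f set \<Rightarrow> nat set" where
  "gaps K R = UNIV - weierstrass_semigroup K R"

definition weierstrass_semigroup2 :: "'f::field set \<Rightarrow> 'f set \<Rightarrow> 'f set \<Rightarrow> (nat \<times> nat) set" where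
  "weierstrass_semigroup2 K R1 R2 =
     {(n1, n2). \<exists>z. z \<noteq> 0 \<and>
        pole_divisor K z = (\<lambda>P. place_divisor n1 R1 P + place_divisor n2 R2 P)}"

definition min_partner :: "'f::field set \<Rightarrow> 'f set \<Rightarrow> 'f set \<Rightarrow> nat \<Rightarrow> nat" where
  "min_partner K R1 R2 b = (LEAST c. (b, c) \<in> weierstrass_semigroup2 K R1 R2)"

definition Gamma_set :: "'f::field set \<Rightarrow> 'f set \<Rightarrow> 'f set \<Rightarrow> (nat \<times> nat) set" where
  "Gamma_set K R1 R2 = {(b, min_partner K R1 R2 b) | b. b \<in> gaps K R1}"

end

theory Submission
  imports Defs
begin

text \<open>
  Since \<open>m\<close> is prime to \<open>\<lambda>\<close>, a product of integral powers of \<open>y\<close> and \<open>f(x)\<close> is an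
  \<open>m\<close>-th root of the monic polynomial with the roots of \<open>f\<close>, and \<open>y\<close> is a power of it
  (\<open>root_of_coprime_power\<close>). Thus one may assume \<open>y\<^sup>m = g(x)\<close> with \<open>g\<close> monic of degree \<open>r\<close>
  with simple roots.

  Every \<open>z \<in> F\<close> is \<open>\<Sum>k<m. h\<^sub>k y\<^sup>k\<close> with \<open>h\<^sub>k \<in> K(x)\<close>. At infinity \<open>y\<close> has value \<open>- r\<close>
  and the values of \<open>K(x)\<close> are the multiples of \<open>m\<close>; at a root \<open>\<alpha>\<close> of \<open>g\<close> the value of
  \<open>y\<close> is \<open>1\<close> and again \<open>K(x)\<close> takes its values in the multiples of \<open>m\<close>. In both cases the
  nonzero terms have values that are distinct modulo \<open>m\<close>, so the value of \<open>z\<close> is the least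
  value of a term (\<open>ramified_place\<close>).

  Let \<open>z\<close> have poles only at \<open>P\<^sub>\<infinity>\<close> and at the place \<open>P\<close> over \<open>\<alpha>\<close>. Averaging over
  the conjugates \<open>y \<mapsto> \<zeta> y\<close> shows that no \<open>h\<^sub>k\<close> has a finite pole other than \<open>\<alpha>\<close>
  (\<open>coefficient_regular\<close>), hence the order of \<open>h\<^sub>k\<close> at \<open>\<alpha>\<close> is at most its degree. Let the
  pole order at \<open>P\<^sub>\<infinity>\<close> be \<open>b = m r - m j - r i\<close> with \<open>i, j \<ge> 1\<close>, and let \<open>k\<close> be a term that
  attains it. Reduction modulo \<open>m\<close> gives \<open>k = m - i\<close>, so \<open>h\<^sub>k\<close> has degree \<open>- j\<close>, and the value
  of \<open>z\<close> at \<open>P\<close> is at most \<open>- m j + m - i\<close>. This bounds the pole order at \<open>P\<close> from below by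
  \<open>i + m (j - 1)\<close> (\<open>semigroup2_lower_bound\<close>), and \<open>y\<^bsup>m-i\<^esup> / (x - \<alpha>)\<^sup>j\<close> attains the bound
  (\<open>semigroup2_realize\<close>). The bound being positive, such a \<open>b\<close> is a gap; every other natural
  number has the form \<open>m A + r k\<close> and is the pole order of \<open>x\<^sup>A y\<^sup>k\<close> (\<open>gaps_eq\<close>).

  Three more facts support this argument. The place \<open>P\<close> of the theorem lies over a root of
  \<open>g\<close> because over any other finite point the conjugate places differ
  (\<open>unramified_place_not_unique\<close>). Averaging is useful only because every finite point
  is the center of some place (\<open>ex_valuation_ring_containing\<close>). And the normalized valuation, a
  definite description, is meaningful because all places of \<open>F\<close> are discrete
  (\<open>discrete_if_algebraic_bounded\<close>).
\<close>

section \<open>Subrings and subfields of a field type\<close>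

lemma ambient_simps [simp]:
  "carrier (ambient :: 'f::field ring) = UNIV"
  "monoid.mult (ambient :: 'f::field ring) = (*)"
  "monoid.one (ambient :: 'f::field ring) = 1"
  "ring.add (ambient :: 'f::field ring) = (+)"
  "ring.zero (ambient :: 'f::field ring) = 0"
  by (simp_all add: ring_of_type_algebra_def)

lemma ambient_a_inv [simp]: "a_inv (ambient :: 'f::field ring) z = - z"
proof -
  interpret field "ambient :: 'f ring" by (rule field_from_type_algebra)
  show ?thesis using minus_equality[of "- z" z] by simp
qed

lemma ambient_m_inv [simp]: "z \<noteq> 0 \<Longrightarrow> m_inv (ambient :: 'f::field ring) z = inverse z"
proof -
  interpret field "ambient :: 'f ring" by (rule field_from_type_algebra)
  assume "z \<noteq> 0"
  then show ?thesis using comm_inv_char[of z "inverse z"] by simp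
qed

lemma ambient_nat_pow [simp]: "z [^]\<^bsub>(ambient :: 'f::field ring)\<^esub> (n::nat) = z ^ n"
proof -
  interpret field "ambient :: 'f ring" by (rule field_from_type_algebra)
  show ?thesis by (induction n) (simp_all add: mult.commute)
qed

lemma subring_ambient_iff:
  "subring V (ambient :: 'f::field ring) \<longleftrightarrow>
     1 \<in> V \<and> (\<forall>z\<in>V. - z \<in> V) \<and> (\<forall>z\<in>V. \<forall>w\<in>V. z * w \<in> V) \<and> (\<forall>z\<in>V. \<forall>w\<in>V. z + w \<in> V)"
proof -
  interpret field "ambient :: 'f ring" by (rule field_from_type_algebra)
  show ?thesis
    using subringI[of V] subringE[of V "ambient :: 'f ring"] by auto
qed

lemma subfield_ambient_iff:
  "subfield E (ambient :: 'f::field ring) \<longleftrightarrow> subring E ambient \<and> (\<forall>z\<in>E. inverse z \<in> E)"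
proof -
  interpret field "ambient :: 'f ring" by (rule field_from_type_algebra)
  show ?thesis
  proof
    assume E: "subfield E ambient"
    have "inverse z \<in> E" if "z \<in> E" for z
    proof (cases "z = 0")
      case True then show ?thesis using that by simp
    next
      case False then show ?thesis using subfield_m_inv(1)[OF E, of z] that by simp
    qed
    then show "subring E ambient \<and> (\<forall>z\<in>E. inverse z \<in> E)" using subfieldE(1)[OF E] by blast
  next
    assume "subring E ambient \<and> (\<forall>z\<in>E. inverse z \<in> E)"
    then show "subfield E ambient" by (intro subfieldI') auto
  qed
qed

lemma subring_ambient_0: "subring V (ambient :: 'f::field ring) \<Longrightarrow> 0 \<in> V"
  unfolding subring_ambient_iff by (metis add.right_inverse)

lemma subring_ambient_sum:
  assumes "subring V (ambient :: 'f::field ring)" "\<And>i. i \<in> I \<Longrightarrow> f i \<in> V"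
  shows "sum f I \<in> V"
  using assms(2) by (induction I rule: infinite_finite_induct)
    (use assms(1) subring_ambient_0[OF assms(1)] in \<open>auto simp: subring_ambient_iff\<close>)

lemma subring_ambient_power:
  assumes "subring V (ambient :: 'f::field ring)" "z \<in> V"
  shows "z ^ n \<in> V"
  using assms by (induction n) (auto simp: subring_ambient_iff)

lemma subring_ambient_diff:
  assumes "subring V (ambient :: 'f::field ring)" "z \<in> V" "w \<in> V"
  shows "z - w \<in> V"
  using assms unfolding subring_ambient_iff by (metis add_uminus_conv_diff)


section \<open>Places and their valuation rings\<close>

text \<open>
  Until \<open>P\<close> is known to be discrete there is no valuation to work with, and all arguments refer to
  the valuation ring \<open>V\<close>, its maximal ideal \<open>P\<close> and its units \<open>U\<close>, that is, to elements of
  non-negative, positive and zero value.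
\<close>

locale field_place =
  fixes K E P :: "'f::field set"
  assumes place_P: "place K E P" and subfield_E: "subfield E ambient"
begin

abbreviation V where "V \<equiv> ring_of_place E P"
abbreviation U where "U \<equiv> V - P"

lemma valuation_ring_V: "valuation_ring K E V"
  and P_eq: "P = {z \<in> V. \<not> (z \<noteq> 0 \<and> inverse z \<in> V)}"
proof -
  obtain W where W: "valuation_ring K E W" "P = {z \<in> W. \<not> (z \<noteq> 0 \<and> inverse z \<in> W)}"
    using place_P unfolding place_def by blast
  have "0 \<in> W" using W(1) subring_ambient_0 unfolding valuation_ring_def by blast
  then have "V = W"
    using W unfolding ring_of_place_def valuation_ring_def by auto
  then show "valuation_ring K E V" "P = {z \<in> V. \<not> (z \<noteq> 0 \<and> inverse z \<in> V)}" using W by auto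
qed

lemma subring_V: "subring V ambient" and K_V: "K \<subset> V" and V_E: "V \<subset> E"
  and V_or_inverse: "z \<in> E \<Longrightarrow> z \<in> V \<or> inverse z \<in> V"
  using valuation_ring_V unfolding valuation_ring_def by auto

lemma E_closed: "1 \<in> E" "0 \<in> E" "z \<in> E \<Longrightarrow> - z \<in> E" "z \<in> E \<Longrightarrow> inverse z \<in> E"
  "z \<in> E \<Longrightarrow> w \<in> E \<Longrightarrow> z * w \<in> E" "z \<in> E \<Longrightarrow> w \<in> E \<Longrightarrow> z + w \<in> E"
  "z \<in> E \<Longrightarrow> w \<in> E \<Longrightarrow> z / w \<in> E"
  using subfield_E subring_ambient_0[of E] unfolding subfield_ambient_iff subring_ambient_iff
  by (auto simp: divide_inverse)

lemma V_closed: "1 \<in> V" "0 \<in> V" "z \<in> V \<Longrightarrow> - z \<in> V" 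
  "z \<in> V \<Longrightarrow> w \<in> V \<Longrightarrow> z * w \<in> V" "z \<in> V \<Longrightarrow> w \<in> V \<Longrightarrow> z + w \<in> V"
  "z \<in> V \<Longrightarrow> w \<in> V \<Longrightarrow> z - w \<in> V" "z \<in> V \<Longrightarrow> z ^ n \<in> V"
  using subring_V subring_ambient_0[OF subring_V] subring_ambient_diff[OF subring_V]
    subring_ambient_power[OF subring_V] unfolding subring_ambient_iff by auto

lemma P_iff: "z \<in> P \<longleftrightarrow> z \<in> V \<and> (z = 0 \<or> inverse z \<notin> V)"
  by (subst P_eq) blast

lemma U_iff: "z \<in> U \<longleftrightarrow> z \<in> V \<and> z \<noteq> 0 \<and> inverse z \<in> V"
  using P_iff by blast

lemma U_nonzero: "z \<in> U \<Longrightarrow> z \<noteq> 0" using U_iff by blast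

lemma P_if_not_V: "z \<in> E \<Longrightarrow> z \<notin> V \<Longrightarrow> inverse z \<in> P"
  using V_or_inverse[of z] P_iff[of "inverse z"] by auto

lemma V_E': "z \<in> V \<Longrightarrow> z \<in> E" using V_E by blast

lemma one_U: "1 \<in> U" unfolding U_iff using V_closed(1) by simp
lemma one_notin_P: "1 \<notin> P" using one_U by blast
lemma zero_P: "0 \<in> P" using P_iff V_closed(2) by blast

lemma U_mult: "z \<in> U \<Longrightarrow> w \<in> U \<Longrightarrow> z * w \<in> U"
  unfolding U_iff by (auto intro: V_closed)

lemma U_inverse: "z \<in> U \<Longrightarrow> inverse z \<in> U"
  unfolding U_iff by auto

lemma U_divide: "z \<in> U \<Longrightarrow> w \<in> U \<Longrightarrow> z / w \<in> U"
  by (simp add: divide_inverse U_mult U_inverse del: Diff_iff)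

lemma U_power: "z \<in> U \<Longrightarrow> z ^ n \<in> U"
  by (induction n) (auto simp: one_U U_mult simp del: Diff_iff)

lemma U_powi: "z \<in> U \<Longrightarrow> z powi n \<in> U"
  by (auto simp: power_int_def U_power U_inverse simp del: Diff_iff)


lemma P_V: "z \<in> P \<Longrightarrow> z \<in> V" using P_iff by blast

lemma P_mult: assumes "z \<in> P" "w \<in> V" shows "z * w \<in> P"
proof (rule ccontr)
  assume "z * w \<notin> P"
  then have *: "z * w \<in> U" using assms P_V V_closed by blast
  then have "w * inverse (z * w) \<in> V" using assms U_iff V_closed(4) by blast
  moreover have "w \<noteq> 0" using * unfolding U_iff by auto
  then have "w * inverse (z * w) = inverse z" by (simp add: field_simps)
  ultimately have "inverse z \<in> V" by (simp only:)
  moreover have "z \<noteq> 0" using * unfolding U_iff by auto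
  ultimately show False using assms P_iff[of z] by auto
qed

lemma P_mult': "w \<in> V \<Longrightarrow> z \<in> P \<Longrightarrow> w * z \<in> P"
  using P_mult by (metis mult.commute)

lemma P_uminus: "z \<in> P \<Longrightarrow> - z \<in> P"
  using P_mult[of z "-1"] V_closed by auto

lemma P_add: assumes "z \<in> P" "w \<in> P" shows "z + w \<in> P"
proof (cases "z = 0 \<or> w = 0")
  case True then show ?thesis using assms by auto
next
  case False
  have *: "z / w \<in> V \<or> w / z \<in> V"
    using V_or_inverse[of "z / w"] E_closed(7) V_E' P_V assms by auto
  have eq: "z + w = w * (1 + z / w)" "z + w = z * (1 + w / z)" using False by (auto simp: field_simps)
  from * show ?thesis
  proof
    assume "z / w \<in> V"
    then show ?thesis unfolding eq(1) by (intro P_mult assms V_closed(1,5))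
  next
    assume "w / z \<in> V"
    then show ?thesis unfolding eq(2) by (intro P_mult assms V_closed(1,5))
  qed
qed

lemma P_diff: "z \<in> P \<Longrightarrow> w \<in> P \<Longrightarrow> z - w \<in> P"
  using P_add[of z "- w"] P_uminus by auto

lemma P_sum: "(\<And>i. i \<in> I \<Longrightarrow> f i \<in> P) \<Longrightarrow> sum f I \<in> P"
  by (induction I rule: infinite_finite_induct) (auto intro: zero_P P_add)

lemma U_add_P: assumes "z \<in> U" "w \<in> P" shows "z + w \<in> U"
proof (rule ccontr)
  assume "z + w \<notin> U"
  then have "z + w \<in> P" using assms P_V V_closed by blast
  then have "z \<in> P" using P_diff[OF _ assms(2)] by fastforce
  then show False using assms by blast
qed

lemma P_prime: assumes "z \<in> V" "w \<in> V" "z * w \<in> P" shows "z \<in> P \<or> w \<in> P"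
  using assms U_mult[of z w] by blast


lemma V_if_power_V: assumes "z \<in> E" "z ^ n \<in> V" "n > 0" shows "z \<in> V"
proof (rule ccontr)
  assume z: "z \<notin> V"
  then have "inverse z \<in> P" using P_if_not_V assms by blast
  moreover obtain k where k: "n = Suc k" using assms(3) gr0_implies_Suc by blast
  ultimately have "inverse z ^ n \<in> P"
    unfolding k power_Suc by (intro P_mult V_closed(7) P_V)
  then have "inverse z ^ n * z ^ n \<in> P" using P_mult assms by blast
  moreover have "z \<noteq> 0" using z V_closed(2) by blast
  then have "inverse z ^ n * z ^ n = 1" by (simp flip: power_mult_distrib)
  ultimately show False using one_notin_P by simp
qed


text \<open>
  The exponent \<open>n\<close> behaves as a value of \<open>s\<^sup>n u\<close>, whether or not \<open>s\<close> is a prime element.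
\<close>

lemma powi_in_V_P_iff:
  assumes t_P: "t \<in> P" and t_nonzero: "t \<noteq> 0" and u: "u \<in> U"
  shows "t powi n * u \<in> V \<longleftrightarrow> n \<ge> 0"
  and "t powi n * u \<in> P \<longleftrightarrow> n > 0"
proof -
  have pos: "t powi n * u \<in> P" if "n > 0" "u \<in> U" for n u
  proof -
    have "t ^ (nat n - 1) * u \<in> V" using that by (intro V_closed P_V[OF t_P]) simp
    then have "t * (t ^ (nat n - 1) * u) \<in> P" using t_P P_mult by blast
    moreover have "t powi n = t * t ^ (nat n - 1)"
      using that power_Suc[of t "nat n - 1"] by (simp add: power_int_def)
    ultimately show ?thesis by (simp add: mult.assoc)
  qed
  have neg: "t powi n * u \<notin> V" if n: "n < 0" and u: "u \<in> U" for n u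
  proof
    assume a: "t powi n * u \<in> V"
    have "t powi (-n) * inverse u \<in> P" using pos n u U_inverse by auto
    then have "(t powi n * u) * (t powi (-n) * inverse u) \<in> P" using a P_mult' by blast
    moreover have "(t powi n * u) * (t powi (-n) * inverse u) = 1"
      using t_nonzero U_nonzero[OF u] by (simp add: power_int_minus field_simps)
    ultimately show False using one_notin_P by simp
  qed
  have zero: "t powi n * u \<in> U" if "n = 0" using that u by simp
  show "t powi n * u \<in> V \<longleftrightarrow> n \<ge> 0" "t powi n * u \<in> P \<longleftrightarrow> n > 0"
    using pos[OF _ u, of n] neg[OF _ u, of n] zero P_V[of "t powi n * u"]
    by (cases n "0::int" rule: linorder_cases; force)+
qed

text \<open>
  Divide the sum by a term of least value: if all other quotients had positive value, then the
  relation would place \<open>1\<close> in \<open>P\<close>. So the least value is attained twice.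
\<close>

lemma vanishing_sum_two_associated_terms:
  assumes "finite I" "sum f I = 0" "\<exists>i\<in>I. f i \<noteq> 0" "\<And>i. i \<in> I \<Longrightarrow> f i \<in> E"
  shows "\<exists>i\<in>I. \<exists>j\<in>I. i \<noteq> j \<and> f i \<noteq> 0 \<and> f j \<noteq> 0 \<and> f i / f j \<in> U"
proof -
  define J where "J = {i\<in>I. f i \<noteq> 0}"
  have J: "finite J" "J \<noteq> {}" "J \<subseteq> I" using assms unfolding J_def by auto
  have J0: "f i \<noteq> 0" if "i \<in> J" for i using that unfolding J_def by auto
  have "\<exists>j\<in>J. \<forall>i\<in>J. f i / f j \<in> V" using J(1,2) J0 assms(4) J(3)
  proof (induction J rule: finite_ne_induct)
    case (singleton j) then show ?case using V_closed(1) by auto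
  next
    case (insert k J)
    then obtain j where j: "j \<in> J" "\<forall>i\<in>J. f i / f j \<in> V" by auto
    have nz: "f j \<noteq> 0" "f k \<noteq> 0" using insert.prems j by auto
    have "f j / f k \<in> E" using insert.prems j E_closed(7) by auto
    then consider "f k / f j \<in> V" | "f j / f k \<in> V" using V_or_inverse[of "f j / f k"] by auto
    then show ?case
    proof cases
      case 1 then show ?thesis using j by auto
    next
      case 2
      have "f i / f k \<in> V" if "i \<in> J" for i
        using V_closed(4)[of "f i / f j" "f j / f k"] j that 2 nz by auto
      moreover have "f k / f k \<in> V" using nz V_closed(1) by simp
      ultimately show ?thesis by auto
    qed
  qed
  then obtain j where j: "j \<in> J" "\<forall>i\<in>J. f i / f j \<in> V" by auto
  have "\<exists>i\<in>J - {j}. f i / f j \<in> U"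
  proof (rule ccontr)
    assume "\<not> ?thesis"
    then have "(\<Sum>i\<in>J-{j}. f i / f j) \<in> P" using j by (intro P_sum) auto
    moreover have "sum f J = sum f I"
      using assms(1) unfolding J_def by (intro sum.mono_neutral_left) auto
    then have "sum f J = 0" using assms(2) by simp
    then have "f j + sum f (J - {j}) = 0" using J(1) j(1) by (simp add: sum.remove)
    then have "(\<Sum>i\<in>J-{j}. f i / f j) = - 1"
      using J0[OF j(1)] by (simp add: sum_divide_distrib[symmetric] eq_neg_iff_add_eq_0 field_simps)
    ultimately have "-1 \<in> P" by simp
    then have "- (-1) \<in> P" by (rule P_uminus)
    then show False using one_notin_P by simp
  qed
  then obtain i where "i \<in> J - {j}" "f i / f j \<in> U" by blast
  then show ?thesis using J j J0 by (intro bexI[of _ i] bexI[of _ j]) auto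
qed

end

section \<open>Discrete places and the normalized valuation\<close>

text \<open>
  The existence of such a \<open>t\<close> is what makes the definite description in \<open>val\<close> well defined.
\<close>

locale discrete_place = field_place +
  fixes t :: 'a
  assumes t_P: "t \<in> P" and t_nonzero: "t \<noteq> 0"
    and uniformizer: "z \<in> E \<Longrightarrow> z \<noteq> 0 \<Longrightarrow> \<exists>n. \<exists>u\<in>U. z = t powi n * u"
begin

lemmas powi_unit_V = powi_in_V_P_iff[OF t_P t_nonzero]

lemma prime_element_iff: "prime_element E P s \<longleftrightarrow> (\<exists>u\<in>U. s = t * u)"
proof
  assume s: "prime_element E P s"
  then have "t \<in> (\<lambda>a. s * a) ` V" using t_P unfolding prime_element_def by auto
  then obtain a where a: "a \<in> V" "t = s * a" by auto
  have "s \<in> P" using s V_closed(1) unfolding prime_element_def by (metis image_eqI mult.right_neutral)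
  then obtain n u where n: "u \<in> U" "s = t powi n * u"
    using uniformizer[of s] P_V V_E' a t_nonzero by auto
  have "n > 0" using powi_unit_V(2)[OF n(1)] n \<open>s \<in> P\<close> by simp
  have anz: "a \<noteq> 0" using a t_nonzero by auto
  obtain k w where k: "w \<in> U" "a = t powi k * w" using uniformizer[of a] a V_E' anz by auto
  have "k \<ge> 0" using powi_unit_V(1)[OF k(1), of k] k(2) a(1) by simp
  have "t powi (n + k) * (u * w) = (t powi n * u) * (t powi k * w)"
    unfolding power_int_add[OF disjI1[OF t_nonzero]] by (simp only: mult_ac)
  then have "t powi (n + k) * (u * w) = t" unfolding n(2)[symmetric] k(2)[symmetric] a(2)[symmetric] .
  then have "t powi (n + k - 1) * (u * w) = 1"
    using t_nonzero by (simp add: power_int_diff)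
  then have "\<not> (n + k - 1 > 0)" using powi_unit_V(2)[OF U_mult[OF n(1) k(1)]] one_notin_P by metis
  then have "n = 1" using \<open>n > 0\<close> \<open>k \<ge> 0\<close> by linarith
  then show "\<exists>u\<in>U. s = t * u" using n by auto
next
  assume "\<exists>u\<in>U. s = t * u"
  then obtain u where u: "u \<in> U" "s = t * u" by blast
  show "prime_element E P s" unfolding prime_element_def
  proof (intro equalityI subsetI)
    fix z assume z: "z \<in> P"
    show "z \<in> (\<lambda>a. s * a) ` V"
    proof (cases "z = 0")
      case True then show ?thesis using V_closed(2) by (intro image_eqI[of _ _ 0]) auto
    next
      case False
      then obtain n w where n: "w \<in> U" "z = t powi n * w" using uniformizer[of z] z P_V V_E' by auto
      have "n > 0" using powi_unit_V(2)[OF n(1)] n z by simp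
      then have "t powi (n - 1) * (w / u) \<in> V" using powi_unit_V(1)[OF U_divide[OF n(1) u(1)]] by simp
      moreover have "z = s * (t powi (n - 1) * (w / u))"
        unfolding n u using t_nonzero U_nonzero[OF u(1)] by (simp add: power_int_diff field_simps)
      ultimately show ?thesis by blast
    qed
  next
    fix z assume "z \<in> (\<lambda>a. s * a) ` V"
    then obtain a where "a \<in> V" "z = t * (u * a)" using u by (auto simp: mult.assoc)
    then show "z \<in> P" using u t_P P_mult V_closed(4) by auto
  qed
qed

text \<open>
  Any two prime elements differ by a unit, so the exponent does not depend on the prime element.
\<close>

lemma val_eqI: assumes "u \<in> U" "z = t powi n * u" shows "val E P z = n"
  unfolding val_def
proof (rule the_equality)
  show "\<exists>t' u. prime_element E P t' \<and> u \<in> U \<and> z = t' powi n * u"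
    using prime_element_iff one_U assms by (metis mult.right_neutral)
next
  fix k assume "\<exists>t' u. prime_element E P t' \<and> u \<in> U \<and> z = t' powi k * u"
  then obtain t' w' where t': "prime_element E P t'" "w' \<in> U" "z = t' powi k * w'" by blast
  obtain w where "w \<in> U" "t' = t * w" using t'(1) unfolding prime_element_iff by (elim bexE)
  then have w: "w \<in> U" "w' \<in> U" "z = (t * w) powi k * w'" using t' by simp_all
  define q where "q = w powi k * w' / u"
  have q: "q \<in> U" unfolding q_def by (intro U_divide U_mult U_powi w assms)
  have "t powi (k - n) * q = 1"
    using w(3) t_nonzero U_nonzero[OF assms(1)] U_nonzero[OF w(1)] U_nonzero[OF w(2)]
    unfolding q_def assms(2)
    by (simp add: power_int_mult_distrib power_int_diff field_simps)
  then have "k - n \<ge> 0" "\<not> k - n > 0" using powi_unit_V[OF q, of "k - n"] one_U by auto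
  then show "k = n" by linarith
qed

lemma unit_decomposition:
  assumes "z \<in> E" "z \<noteq> 0" obtains u where "u \<in> U" "z = t powi (val E P z) * u"
  using uniformizer[OF assms] val_eqI by metis

lemma val_mult:
  assumes "z \<in> E" "z \<noteq> 0" "w \<in> E" "w \<noteq> 0" shows "val E P (z * w) = val E P z + val E P w"
proof -
  obtain u where u: "u \<in> U" "z = t powi (val E P z) * u" using unit_decomposition assms by blast
  obtain u' where u': "u' \<in> U" "w = t powi (val E P w) * u'" using unit_decomposition assms by blast
  show ?thesis
    by (rule val_eqI[OF U_mult[OF u(1) u'(1)]])
       (subst u(2), subst u'(2), simp add: power_int_add t_nonzero)
qed

lemma val_V: assumes "z \<in> E" "z \<noteq> 0" shows "z \<in> V \<longleftrightarrow> val E P z \<ge> 0"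
  using unit_decomposition[OF assms] powi_unit_V(1) by metis

lemma val_P: assumes "z \<in> E" "z \<noteq> 0" shows "z \<in> P \<longleftrightarrow> val E P z > 0"
  using unit_decomposition[OF assms] powi_unit_V(2) by metis

lemma val_U: assumes "z \<in> U" shows "val E P z = 0"
  using val_eqI[of z z 0] assms by simp

lemma val_1: "val E P 1 = 0" using val_U one_U .

lemma val_t: "val E P t = 1"
  using val_eqI[of 1 t 1] one_U by simp

lemma val_inverse: assumes "z \<in> E" "z \<noteq> 0" shows "val E P (inverse z) = - val E P z"
  using val_mult[of z "inverse z"] assms E_closed(4) val_1 by simp

lemma val_divide:
  assumes "z \<in> E" "z \<noteq> 0" "w \<in> E" "w \<noteq> 0" shows "val E P (z / w) = val E P z - val E P w"
  using val_mult[of z "inverse w"] assms E_closed(4) val_inverse by (simp add: divide_inverse)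

lemma val_power: assumes "z \<in> E" "z \<noteq> 0" shows "val E P (z ^ n) = int n * val E P z"
proof (induction n)
  case 0 then show ?case using val_1 by simp
next
  case (Suc n)
  have "z ^ n \<in> E" using assms(1) by (induction n) (auto simp: E_closed)
  then show ?case using val_mult[of z "z ^ n"] assms Suc by (simp add: algebra_simps)
qed

lemma val_powi: assumes "z \<in> E" "z \<noteq> 0" shows "val E P (z powi n) = n * val E P z"
  using assms val_power[of z] val_power[of "inverse z"] val_inverse E_closed(4)
  by (simp add: power_int_def)

lemma val_add_strict:
  assumes "z \<in> E" "z \<noteq> 0" "w \<in> E" "w \<noteq> 0" "val E P z < val E P w"
  shows "z + w \<noteq> 0" "val E P (z + w) = val E P z"
proof -
  have "val E P (w / z) > 0" using assms val_divide by simp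
  then have "w / z \<in> P" using val_P E_closed(7) assms by simp
  then have *: "1 + w / z \<in> U" using U_add_P one_U by blast
  have eq: "z + w = z * (1 + w / z)" using assms by (simp add: field_simps)
  show "z + w \<noteq> 0" using eq U_nonzero[OF *] assms by simp
  show "val E P (z + w) = val E P z"
    using val_mult[OF assms(1,2), of "1 + w / z"] val_U[OF *] U_nonzero[OF *] V_E' * eq by auto
qed

text \<open>
  By the strict triangle inequality, terms of distinct values cannot cancel.
\<close>

lemma val_sum_distinct:
  assumes "finite I" "I \<noteq> {}" "\<And>i. i \<in> I \<Longrightarrow> f i \<in> E \<and> f i \<noteq> 0" "inj_on (\<lambda>i. val E P (f i)) I"
  shows "sum f I \<noteq> 0" "val E P (sum f I) = Min ((\<lambda>i. val E P (f i)) ` I)"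
proof -
  have "sum f I \<in> E \<and> sum f I \<noteq> 0 \<and> val E P (sum f I) = Min ((\<lambda>i. val E P (f i)) ` I)"
    using assms
  proof (induction I rule: finite_ne_induct)
    case (singleton i) then show ?case by simp
  next
    case (insert i I)
    let ?v = "\<lambda>i. val E P (f i)"
    have IH: "sum f I \<in> E" "sum f I \<noteq> 0" "val E P (sum f I) = Min (?v ` I)"
      using insert by auto
    have "Min (?v ` I) \<in> ?v ` I" using insert by simp
    moreover have "?v i \<notin> ?v ` I" using insert.prems(2) insert.hyps by auto
    ultimately have ne: "?v i \<noteq> val E P (sum f I)" using IH(3) by metis
    have fi: "f i \<in> E" "f i \<noteq> 0" using insert.prems by auto
    have "f i + sum f I \<noteq> 0 \<and> val E P (f i + sum f I) = min (?v i) (val E P (sum f I))"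
      using val_add_strict[OF fi IH(1,2)] val_add_strict[OF IH(1,2) fi] ne
      by (cases "?v i < val E P (sum f I)") (auto simp: add.commute)
    then show ?case using insert.hyps IH fi E_closed by simp
  qed
  then show "sum f I \<noteq> 0" "val E P (sum f I) = Min ((\<lambda>i. val E P (f i)) ` I)" by auto
qed

end

section \<open>Polynomials over a subring\<close>

definition poly_over :: "'f::field set \<Rightarrow> 'f poly set" where
  "poly_over R = {p. \<forall>i. Polynomial.coeff p i \<in> R}"

lemma poly_over_pCons_iff [simp]: "pCons a p \<in> poly_over R \<longleftrightarrow> a \<in> R \<and> p \<in> poly_over R"
  unfolding poly_over_def by (auto simp: coeff_pCons split: nat.splits)

context
  fixes R :: "'f::field set" assumes R: "subring R ambient"
begin

lemma poly_over_0: "0 \<in> poly_over R"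
  using subring_ambient_0[OF R] unfolding poly_over_def by simp

lemma poly_over_const: "c \<in> R \<Longrightarrow> [:c:] \<in> poly_over R"
  using poly_over_0 by simp

lemma poly_over_1: "1 \<in> poly_over R"
  using R poly_over_const[of 1] unfolding subring_ambient_iff by (simp add: one_pCons)

lemma poly_over_add: "p \<in> poly_over R \<Longrightarrow> q \<in> poly_over R \<Longrightarrow> p + q \<in> poly_over R"
  using R unfolding subring_ambient_iff poly_over_def by simp

lemma poly_over_uminus: "p \<in> poly_over R \<Longrightarrow> - p \<in> poly_over R"
  using R unfolding subring_ambient_iff poly_over_def by simp

lemma poly_over_diff: "p \<in> poly_over R \<Longrightarrow> q \<in> poly_over R \<Longrightarrow> p - q \<in> poly_over R"
  using poly_over_add[of p "- q"] poly_over_uminus by simp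

lemma poly_over_mult: "p \<in> poly_over R \<Longrightarrow> q \<in> poly_over R \<Longrightarrow> p * q \<in> poly_over R"
  using R unfolding poly_over_def
  by (auto intro!: subring_ambient_sum[OF R] simp: subring_ambient_iff Polynomial.coeff_mult)


lemma poly_over_monom: "c \<in> R \<Longrightarrow> Polynomial.monom c n \<in> poly_over R"
  using subring_ambient_0[OF R] unfolding poly_over_def by simp

lemma subring_poly_image: "subring ((\<lambda>p. poly p z) ` poly_over R) ambient"
  unfolding subring_ambient_iff
proof (intro conjI ballI)
  show "1 \<in> (\<lambda>p. poly p z) ` poly_over R"
    using poly_over_1 by (intro image_eqI[of _ _ 1]) auto
next
  fix u assume "u \<in> (\<lambda>p. poly p z) ` poly_over R"
  then obtain p where "u = poly p z" "p \<in> poly_over R" by blast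
  then show "- u \<in> (\<lambda>p. poly p z) ` poly_over R"
    using poly_over_uminus by (intro image_eqI[of _ _ "- p"]) auto
next
  fix u w assume "u \<in> (\<lambda>p. poly p z) ` poly_over R" "w \<in> (\<lambda>p. poly p z) ` poly_over R"
  then obtain p q where "u = poly p z" "p \<in> poly_over R" "w = poly q z" "q \<in> poly_over R" by blast
  then show "u * w \<in> (\<lambda>p. poly p z) ` poly_over R" "u + w \<in> (\<lambda>p. poly p z) ` poly_over R"
    using image_eqI[of "u * w" "\<lambda>p. poly p z" "p * q"] image_eqI[of "u + w" "\<lambda>p. poly p z" "p + q"]
    by (simp_all add: poly_over_mult poly_over_add)
qed

text \<open>
  The inductive definition of a simple extension is Horner's scheme.
\<close>

lemma simple_extension_eq_poly_image:
  "ring.simple_extension ambient R z = (\<lambda>p. poly p z) ` poly_over R" (is "?S = ?T")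
proof -
  interpret field "ambient :: 'f ring" by (rule field_from_type_algebra)
  have "u \<in> ?T" if "u \<in> ?S" for u using that
  proof (induction rule: simple_extension.induct)
    case zero
    then show ?case using poly_over_0 by (intro image_eqI[of _ _ 0]) auto
  next
    case (lin k1 k2)
    then obtain p where "p \<in> poly_over R" "k1 = poly p z" by auto
    then show ?case using lin by (intro image_eqI[of _ _ "pCons k2 p"]) (auto simp: algebra_simps)
  qed
  moreover have "poly p z \<in> ?S" if "p \<in> poly_over R" for p using that
  proof (induction p)
    case 0
    then show ?case using simple_extension.zero[of R z] by simp
  next
    case (pCons a p)
    then have "a \<in> R" "poly p z \<in> ?S" by auto
    then show ?case using simple_extension.lin[of "poly p z" R z a] by (simp add: algebra_simps)
  qed
  ultimately show ?thesis by blast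
qed

end

lemma eval_ambient_eq_poly: "ring.eval ambient ks (z::'f::field) = poly (Poly (rev ks)) z"
proof -
  interpret field "ambient :: 'f ring" by (rule field_from_type_algebra)
  show ?thesis by (induction ks) (auto simp: Poly_snoc poly_monom add.commute)
qed

text \<open>
  The \<open>d + 1\<close> powers \<open>1, z, \<dots>, z\<^sup>d\<close> are dependent in a space of dimension \<open>d\<close>. It matters
  below that the degree is bounded independently of \<open>z\<close>.
\<close>

lemma dimension_imp_algebraic_bounded:
  assumes L: "subfield L (ambient :: 'f::field ring)" and dim: "ring.dimension ambient d L UNIV"
  shows "\<exists>p\<in>poly_over L. p \<noteq> 0 \<and> Polynomial.degree p \<le> d \<and> poly p z = 0"
proof -
  interpret field "ambient :: 'f ring" by (rule field_from_type_algebra)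
  let ?Us = "exp_base z (Suc d)"
  have "dependent L ?Us"
    using independent_length_le_dimension[OF L dim, of ?Us] by (auto simp: exp_base_def)
  then obtain Ks where Ks: "length Ks = Suc d" "combine Ks ?Us = 0" "set Ks \<subseteq> L" "set Ks \<noteq> {0}"
    using dependent_imp_non_trivial_combine[OF L, of ?Us] by (auto simp: exp_base_def)
  have "poly (Poly (rev Ks)) z = 0"
    using combine_eq_eval[of Ks z] Ks(1,2) by (simp add: eval_ambient_eq_poly)
  moreover have "Poly (rev Ks) \<in> poly_over L"
    using Ks(3) subring_ambient_0[OF subfieldE(1)[OF L]] unfolding poly_over_def
    by (auto simp: coeff_Poly_eq nth_default_def) (metis length_rev nth_mem set_rev subsetD)
  moreover have "Poly (rev Ks) \<noteq> 0"
  proof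
    assume "Poly (rev Ks) = 0"
    then have "set (rev Ks) \<subseteq> {0}" by (metis Poly_eq_0 set_replicate_conv_if subset_refl empty_subsetI)
    then show False using Ks(1,4) by (cases Ks) auto
  qed
  moreover have "Polynomial.degree (Poly (rev Ks)) \<le> d"
    using degree_Poly[of "rev Ks"] Ks(1) by (intro degree_le) (auto simp: coeff_Poly_eq nth_default_def)
  ultimately show ?thesis by blast
qed

section \<open>Places of finite extensions are discrete\<close>

text \<open>
  Let \<open>z \<noteq> 0\<close> satisfy an equation of degree at most \<open>d\<close> over \<open>L\<close>. Two of its terms have the same
  value, so some power \<open>z\<^sup>e\<close> with \<open>0 < e \<le> d\<close> has the value of a power of \<open>s\<close>. Hence
  \<open>z\<^bsup>d!\<^esup> = s\<^sup>n u\<close> with \<open>u\<close> a unit: the value group is isomorphic to a subgroup of the integers, and an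
  element whose exponent \<open>n\<close> is the least positive one is a prime element.
\<close>

lemma (in field_place) discrete_if_algebraic_bounded:
  assumes s: "s \<in> P" "s \<noteq> 0" and L: "L \<subseteq> E"
    and base: "\<And>h. h \<in> L \<Longrightarrow> h \<noteq> 0 \<Longrightarrow> \<exists>n. \<exists>u\<in>U. h = s powi n * u"
    and alg: "\<And>z. z \<in> E \<Longrightarrow> \<exists>p\<in>poly_over L. p \<noteq> 0 \<and> Polynomial.degree p \<le> d \<and> poly p z = 0"
  shows "\<exists>t. discrete_place K E P t"
proof -
  have "s \<in> E" using s P_V V_E' by blast
  have powE: "z \<in> E \<Longrightarrow> z ^ n \<in> E" for z n by (induction n) (auto simp: E_closed)
  have powiE: "z \<in> E \<Longrightarrow> z powi n \<in> E" for z n by (auto simp: power_int_def powE E_closed)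
  define N where "N = (fact d :: nat)"
  have N: "N > 0" unfolding N_def by simp
  \<comment> \<open>The value of \<open>z\<close>, measured in units of the value of \<open>s\<close> divided by \<open>N\<close>.\<close>
  define \<phi> where "\<phi> z n \<longleftrightarrow> (\<exists>u\<in>U. z ^ N = s powi n * u)" for z n
  have ex: "\<exists>n. \<phi> z n" if z: "z \<in> E" "z \<noteq> 0" for z
  proof -
    obtain p where p: "p \<in> poly_over L" "p \<noteq> 0" "Polynomial.degree p \<le> d" "poly p z = 0"
      using alg[OF z(1)] by blast
    let ?c = "Polynomial.coeff p"
    let ?I = "{..Polynomial.degree p}"
    have cL: "?c i \<in> L" for i using p(1) unfolding poly_over_def by auto
    have "(\<Sum>i\<in>?I. ?c i * z ^ i) = 0" using p(4) by (simp add: poly_altdef)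
    moreover have "\<exists>i\<in>?I. ?c i * z ^ i \<noteq> 0"
      using p(2) z(2) by (intro bexI[of _ "Polynomial.degree p"]) auto
    moreover have "?c i * z ^ i \<in> E" for i using cL L z(1) powE E_closed(5) by blast
    ultimately obtain i j where ij: "i \<in> ?I" "j \<in> ?I" "i \<noteq> j" "?c i * z ^ i \<noteq> 0" "?c j * z ^ j \<noteq> 0"
      "?c i * z ^ i / (?c j * z ^ j) \<in> U"
      using vanishing_sum_two_associated_terms[of ?I "\<lambda>i. ?c i * z ^ i"] by auto
    \<comment> \<open>The two terms of equal value enter symmetrically; this handles one of their orders.\<close>
    have main: "\<phi> z k'" if ij: "i < j" "j \<le> d" "?c i \<noteq> 0" "?c j \<noteq> 0"
        "?c i * z ^ i / (?c j * z ^ j) \<in> U" and k': "k' = int (N div (j - i)) * (ni - nj)"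
        and ni: "ui \<in> U" "?c i = s powi ni * ui" and nj: "uj \<in> U" "?c j = s powi nj * uj"
      for i j k' ni nj ui uj
    proof -
      define e where "e = j - i"
      have e: "e > 0" "j = i + e" "e dvd N" using ij(1,2) unfolding e_def N_def
        by (auto intro!: dvd_fact)
      define w where "w = ?c i * z ^ i / (?c j * z ^ j)"
      have "w = s powi ni * ui * z ^ i / (s powi nj * uj * z ^ (i + e))"
        unfolding w_def ni(2)[symmetric] nj(2)[symmetric] e(2)[symmetric] ..
      moreover have "w \<noteq> 0" using U_nonzero ij(5) unfolding w_def by blast
      ultimately have "z ^ e = s powi (ni - nj) * (ui / uj / w)"
        using z(2) U_nonzero[OF ni(1)] U_nonzero[OF nj(1)] s(2)
        by (simp add: power_int_diff power_add field_simps)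
      moreover have "ui / uj / w \<in> U" unfolding w_def using ij ni nj U_divide by blast
      ultimately obtain u where u: "u \<in> U" "z ^ e = s powi (ni - nj) * u" by blast
      have "z ^ N = (z ^ e) ^ (N div e)" using e by (simp flip: power_mult)
      also have "\<dots> = s powi k' * u ^ (N div e)"
        unfolding u(2) k' e_def[symmetric] by (simp add: power_mult_distrib power_int_power' mult.commute)
      finally show ?thesis unfolding \<phi>_def using U_power[OF u(1)] by blast
    qed
    obtain ni ui where ni: "ui \<in> U" "?c i = s powi ni * ui" using base[of "?c i"] cL ij by auto
    obtain nj uj where nj: "uj \<in> U" "?c j = s powi nj * uj" using base[of "?c j"] cL ij by auto
    have inv: "?c j * z ^ j / (?c i * z ^ i) \<in> U" using U_inverse[OF ij(6)] by simp
    show ?thesis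
    proof (cases "i < j")
      case True
      then show ?thesis using main[of i j, OF _ _ _ _ ij(6) refl ni nj] ij p(3) by auto
    next
      case False
      then show ?thesis using main[of j i, OF _ _ _ _ inv refl nj ni] ij p(3) by auto
    qed
  qed
  have mult: "\<phi> (z * w) (n + k)" if "\<phi> z n" "\<phi> w k" for z w n k
  proof -
    obtain u where u: "u \<in> U" "z ^ N = s powi n * u" using \<open>\<phi> z n\<close> unfolding \<phi>_def by blast
    obtain u' where u': "u' \<in> U" "w ^ N = s powi k * u'" using \<open>\<phi> w k\<close> unfolding \<phi>_def by blast
    have "(z * w) ^ N = s powi (n + k) * (u * u')"
      unfolding power_mult_distrib u u' using s(2) by (simp add: power_int_add)
    then show ?thesis unfolding \<phi>_def using U_mult[OF u(1) u'(1)] by blast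
  qed
  have powi: "\<phi> (z powi j) (n * j)" if "\<phi> z n" for z n j
  proof -
    obtain u where u: "u \<in> U" "z ^ N = s powi n * u" using \<open>\<phi> z n\<close> unfolding \<phi>_def by blast
    have "(z powi j) ^ N = (z ^ N) powi j" 
      by (simp add: power_int_power power_int_power' mult.commute)
    also have "\<dots> = s powi (n * j) * u powi j"
      unfolding u by (simp add: power_int_mult_distrib power_int_mult)
    finally show ?thesis unfolding \<phi>_def using U_powi[OF u(1)] by blast
  qed
  have unit: "z \<in> U" if "\<phi> z 0" "z \<in> E" for z
  proof -
    have *: "z ^ N \<in> U" using that(1) unfolding \<phi>_def by auto
    then have "z \<in> V" using V_if_power_V[OF that(2) _ N] by blast
    moreover have "inverse z \<in> V"
      using V_if_power_V[of "inverse z" N] U_inverse[OF *] N E_closed(4)[OF that(2)]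
      by (auto simp: power_inverse)
    moreover have "z \<noteq> 0" using * N zero_P by (auto simp: power_0_left)
    ultimately show ?thesis unfolding U_iff by blast
  qed
  have pos: "n > 0" if "\<phi> z n" "z \<in> P" for z n
  proof -
    obtain u where u: "u \<in> U" "z ^ N = s powi n * u" using \<open>\<phi> z n\<close> unfolding \<phi>_def by blast
    obtain k where "N = Suc k" using N gr0_implies_Suc by blast
    then have "z ^ N \<in> P" using P_mult[OF that(2), of "z ^ k"] P_V[OF that(2)] V_closed(7) by auto
    then show ?thesis using powi_in_V_P_iff(2)[OF s u(1)] u(2) by simp
  qed
  \<comment> \<open>The positive values that occur; the least one is a generator by division with remainder.\<close>
  define A where "A = {k. k > 0 \<and> (\<exists>t\<in>E. t \<noteq> 0 \<and> \<phi> t (int k))}"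
  have "\<phi> s (int N)" unfolding \<phi>_def using one_U by (intro bexI[of _ 1]) auto
  then have "N \<in> A" using N s \<open>s \<in> E\<close> unfolding A_def by auto
  define g where "g = (LEAST k. k \<in> A)"
  have "g \<in> A" unfolding g_def using \<open>N \<in> A\<close> by (rule LeastI)
  have least: "k \<in> A \<Longrightarrow> g \<le> k" for k unfolding g_def by (rule Least_le)
  obtain t where t: "t \<in> E" "t \<noteq> 0" "\<phi> t (int g)" and g: "g > 0" using \<open>g \<in> A\<close> unfolding A_def by auto
  have dec: "\<exists>n. \<exists>u\<in>U. z = t powi n * u" if z: "z \<in> E" "z \<noteq> 0" for z
  proof -
    obtain n where n: "\<phi> z n" using ex[OF z] by blast
    define q where "q = n div int g"
    define w where "w = z * t powi (- q)"
    have w: "w \<in> E" "w \<noteq> 0" unfolding w_def using z t powiE E_closed(5) by auto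
    have "\<phi> w (n + int g * (- q))" unfolding w_def by (intro mult powi n t(3))
    also have "n + int g * (- q) = n mod int g" unfolding q_def by (simp add: minus_mult_div_eq_mod)
    finally have \<phi>w: "\<phi> w (n mod int g)" .
    have "n mod int g = 0"
    proof (rule ccontr)
      assume "n mod int g \<noteq> 0"
      then have r: "n mod int g > 0" "n mod int g < int g"
        using g pos_mod_sign[of "int g" n] pos_mod_bound[of "int g" n] by linarith+
      define k where "k = nat (n mod int g)"
      have "k > 0" "int k = n mod int g" "k < g" using r unfolding k_def by auto
      then have "k \<in> A" unfolding A_def using w \<phi>w by auto
      then show False using least[of k] \<open>k < g\<close> by simp
    qed
    then have "w \<in> U" using unit \<phi>w w by simp
    moreover have "z = t powi q * w" unfolding w_def using t(2) by (simp add: power_int_minus)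
    ultimately show ?thesis by blast
  qed
  have tP: "t \<in> P"
  proof (rule ccontr)
    assume "t \<notin> P"
    obtain n u where n: "u \<in> U" "s = t powi n * u" using dec[OF \<open>s \<in> E\<close> s(2)] by blast
    show False
    proof (cases "t \<in> V")
      case True
      then have "t \<in> U" using \<open>t \<notin> P\<close> by blast
      then show False using n s U_mult[OF U_powi[OF \<open>t \<in> U\<close>] n(1), of n] by simp
    next
      case False
      then have "inverse t \<in> P" using P_if_not_V t by blast
      moreover have "\<phi> (inverse t) (int g * (-1))" using powi[OF t(3), of "-1"] by simp
      ultimately show False using pos[of "inverse t"] g by fastforce
    qed
  qed
  have "discrete_place K E P t" by unfold_locales (use tP t dec in auto)
  then show ?thesis by blast
qed

section \<open>Existence of places\<close>

text \<open>
  Write \<open>1 - b\<^sub>0\<close> by the second equation as a combination of negative powers of \<open>z\<close>. Multiplying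
  the first equation by \<open>1 - b\<^sub>0\<close> and substituting this in the leading term only turns that term into
  a combination of \<open>z\<^sup>n, \<dots>, 1\<close> and so lowers the degree.
\<close>

lemma unit_equation_reduce:
  fixes z :: "'f::field"
  assumes R: "subring R ambient" and z: "z \<noteq> 0"
    and J: "J \<subseteq> R" "\<And>u w. u \<in> J \<Longrightarrow> w \<in> J \<Longrightarrow> u + w \<in> J" "\<And>u w. u \<in> J \<Longrightarrow> w \<in> R \<Longrightarrow> u * w \<in> J" "0 \<in> J"
    and a: "\<And>i. a i \<in> J" "(\<Sum>i\<le>Suc n. a i * z ^ i) = 1"
    and b: "\<And>i. b i \<in> J" "(\<Sum>i\<le>Suc n. b i * inverse z ^ i) = 1"
  shows "\<exists>c. (\<forall>i. c i \<in> J) \<and> (\<Sum>i\<le>n. c i * z ^ i) = 1"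
proof -
  define c where "c j = (if j = 0 then b 0 else 0) + a j * (1 - b 0) + a (Suc n) * b (Suc n - j)" for j
  have "1 - b 0 \<in> R" using subring_ambient_diff[OF R] R b J unfolding subring_ambient_iff by blast
  then have "c j \<in> J" for j unfolding c_def using a b J by (auto intro!: J(2,3))
  moreover have "(\<Sum>i\<le>n. c i * z ^ i) = 1"
  proof -
    have b0: "1 - b 0 = (\<Sum>i\<le>n. b (Suc i) * inverse z ^ Suc i)"
      using b(2) unfolding sum.atMost_Suc_shift by (simp add: algebra_simps)
    have "(1 - b 0) * z ^ Suc n = (\<Sum>i\<le>n. b (Suc i) * z ^ (n - i))"
      unfolding b0 sum_distrib_right
    proof (rule sum.cong[OF refl])
      fix i assume "i \<in> {..n}"
      then have "z ^ Suc n = z ^ Suc i * z ^ (n - i)" by (simp flip: power_add)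
      then show "b (Suc i) * inverse z ^ Suc i * z ^ Suc n = b (Suc i) * z ^ (n - i)"
        using z by (simp add: power_inverse field_simps)
    qed
    also have "\<dots> = (\<Sum>j\<le>n. b (Suc n - j) * z ^ j)"
      by (rule sum.reindex_bij_witness[of _ "\<lambda>j. n - j" "\<lambda>j. n - j"]) (auto simp: Suc_diff_le)
    finally have top: "(1 - b 0) * z ^ Suc n = (\<Sum>j\<le>n. b (Suc n - j) * z ^ j)" .
    have "(\<Sum>i\<le>n. c i * z ^ i) = (\<Sum>i\<le>n. (if i = 0 then b 0 else 0) * z ^ i)
        + (\<Sum>i\<le>n. a i * z ^ i) * (1 - b 0) + a (Suc n) * (\<Sum>j\<le>n. b (Suc n - j) * z ^ j)"
      unfolding c_def distrib_right sum.distrib by (simp add: sum_distrib_left sum_distrib_right mult_ac)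
    also have "(\<Sum>i\<le>n. (if i = 0 then b 0 else 0) * z ^ i) = b 0"
      using sum.delta[of "{..n}" 0 "\<lambda>i. b 0 * z ^ i"] by (simp add: if_distrib[of "\<lambda>u. u * _"] cong: if_cong)
    also have "b 0 + (\<Sum>i\<le>n. a i * z ^ i) * (1 - b 0) + a (Suc n) * (\<Sum>j\<le>n. b (Suc n - j) * z ^ j)
        = b 0 + (1 - b 0) * (\<Sum>i\<le>Suc n. a i * z ^ i)"
      unfolding top[symmetric] by (simp add: algebra_simps)
    finally show ?thesis using a(2) by simp
  qed
  ultimately show ?thesis by blast
qed

text \<open>
  Chevalley's extension theorem for a principal ideal. Take \<open>M\<close> maximal among the overrings of \<open>R\<close>
  in which \<open>s\<close> stays a non-unit. If neither \<open>z\<close> nor its inverse were in \<open>M\<close>, then \<open>s\<close> would become a unit in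
  \<open>M[z]\<close> and in \<open>M[1/z]\<close>; the two resulting equations with coefficients in \<open>s M\<close> can be reduced
  against each other down to degree \<open>0\<close>, where they say that \<open>s\<close> is a unit of \<open>M\<close>.
\<close>

lemma ex_valuation_ring_containing:
  assumes R: "subring R (ambient :: 'f::field ring)" and s: "s \<in> R" "inverse s \<notin> R"
  shows "\<exists>V. subring V ambient \<and> R \<subseteq> V \<and> inverse s \<notin> V \<and> (\<forall>z. z \<in> V \<or> inverse z \<in> V)"
proof -
  define A where "A = {W. subring W ambient \<and> R \<subseteq> W \<and> inverse s \<notin> W}"
  have "s \<noteq> 0" using s by auto
  have "\<exists>M\<in>A. \<forall>W\<in>A. M \<subseteq> W \<longrightarrow> W = M"
  proof (rule subset_Zorn_nonempty)
    show "A \<noteq> {}" using R s unfolding A_def by blast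
  next
    fix C assume C: "C \<noteq> {}" "subset.chain A C"
    then have CA: "C \<subseteq> A" and lin: "\<And>W W'. W \<in> C \<Longrightarrow> W' \<in> C \<Longrightarrow> W \<subseteq> W' \<or> W' \<subseteq> W"
      unfolding subset_chain_def by blast+
    have two: "\<exists>W\<in>C. u \<in> W \<and> w \<in> W" if "u \<in> \<Union>C" "w \<in> \<Union>C" for u w using that lin by blast
    have sub: "W \<in> C \<Longrightarrow> subring W ambient" for W using CA unfolding A_def by blast
    have "subring (\<Union>C) ambient" unfolding subring_ambient_iff
    proof (intro conjI ballI)
      obtain W where "W \<in> C" using C by blast
      then show "1 \<in> \<Union>C" using sub[of W] unfolding subring_ambient_iff by blast
    next
      fix u assume "u \<in> \<Union>C"
      then obtain W where "W \<in> C" "u \<in> W" by blast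
      then show "- u \<in> \<Union>C" using sub[of W] unfolding subring_ambient_iff by blast
    next
      fix u w assume "u \<in> \<Union>C" "w \<in> \<Union>C"
      then obtain W where "W \<in> C" "u \<in> W" "w \<in> W" using two by blast
      then show "u * w \<in> \<Union>C" "u + w \<in> \<Union>C"
        using sub[of W] unfolding subring_ambient_iff by blast+
    qed
    then show "\<Union>C \<in> A" using C(1) CA unfolding A_def by blast
  qed
  then obtain M where M: "M \<in> A" "\<And>W. W \<in> A \<Longrightarrow> M \<subseteq> W \<Longrightarrow> W = M" by blast
  have sM: "subring M ambient" "R \<subseteq> M" "inverse s \<notin> M" using M unfolding A_def by auto
  define J where "J = (\<lambda>w. s * w) ` M"
  have "s \<in> M" using s sM by blast
  have J: "J \<subseteq> M" "\<And>u w. u \<in> J \<Longrightarrow> w \<in> J \<Longrightarrow> u + w \<in> J"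
    "\<And>u w. u \<in> J \<Longrightarrow> w \<in> M \<Longrightarrow> u * w \<in> J" "0 \<in> J"
  proof -
    show "J \<subseteq> M" using sM(1) \<open>s \<in> M\<close> unfolding J_def subring_ambient_iff by blast
    show "u + w \<in> J" if "u \<in> J" "w \<in> J" for u w
      using that sM(1) unfolding J_def subring_ambient_iff by (auto simp flip: distrib_left)
    show "u * w \<in> J" if "u \<in> J" "w \<in> M" for u w
      using that sM(1) unfolding J_def subring_ambient_iff by (auto simp: mult.assoc)
    show "0 \<in> J" using subring_ambient_0[OF sM(1)] unfolding J_def by force
  qed
  define T where "T n z \<longleftrightarrow> (\<exists>c. (\<forall>i. c i \<in> J) \<and> (\<Sum>i\<le>n. c i * z ^ i) = 1)" for n and z :: 'f
  have adjoin: "\<exists>n. T n z" if "z \<notin> M" for z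
  proof -
    define W where "W = (\<lambda>p. poly p z) ` poly_over M"
    have "subring W ambient" unfolding W_def by (rule subring_poly_image[OF sM(1)])
    moreover have MW: "M \<subseteq> W"
    proof
      fix c assume "c \<in> M"
      then show "c \<in> W" using poly_over_const[OF sM(1)] unfolding W_def
        by (intro image_eqI[of _ _ "[:c:]"]) auto
    qed
    moreover have "z \<in> W" using poly_over_1[OF sM(1)] subring_ambient_0[OF sM(1)] unfolding W_def
      by (intro image_eqI[of _ _ "[:0,1:]"]) (auto simp: one_pCons)
    then have "W \<noteq> M" using that by blast
    ultimately have "inverse s \<in> W" using M(2)[of W] sM(2) unfolding A_def by blast
    then obtain p where p: "p \<in> poly_over M" "inverse s = poly p z" unfolding W_def by blast
    have "(\<Sum>i\<le>Polynomial.degree p. s * Polynomial.coeff p i * z ^ i) = s * poly p z"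
      by (simp add: poly_altdef sum_distrib_left mult.assoc)
    then have "(\<Sum>i\<le>Polynomial.degree p. s * Polynomial.coeff p i * z ^ i) = 1"
      using p(2) \<open>s \<noteq> 0\<close> by (metis right_inverse)
    moreover have "s * Polynomial.coeff p i \<in> J" for i using p(1) unfolding J_def poly_over_def by blast
    ultimately show ?thesis unfolding T_def
      by (intro exI[of _ "Polynomial.degree p"] exI[of _ "\<lambda>i. s * Polynomial.coeff p i"]) auto
  qed
  have mono: "T k z" if "T n z" "n \<le> k" for n k z
  proof -
    obtain c where c: "\<forall>i. c i \<in> J" "(\<Sum>i\<le>n. c i * z ^ i) = 1" using \<open>T n z\<close> unfolding T_def by blast
    have "(\<Sum>i\<le>k. (if i \<le> n then c i else 0) * z ^ i) = (\<Sum>i\<le>n. c i * z ^ i)"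
      using that(2) by (intro sum.mono_neutral_cong_right) auto
    then show ?thesis unfolding T_def using c J(4) by (intro exI[of _ "\<lambda>i. if i \<le> n then c i else 0"]) auto
  qed
  have reduce: "T n z" if Tz: "T (Suc n) z" "T (Suc n) (inverse z)" and "z \<noteq> 0" for n z
  proof -
    obtain a where a: "\<forall>i. a i \<in> J" "(\<Sum>i\<le>Suc n. a i * z ^ i) = 1" using Tz(1) unfolding T_def by blast
    obtain b where b: "\<forall>i. b i \<in> J" "(\<Sum>i\<le>Suc n. b i * inverse z ^ i) = 1"
      using Tz(2) unfolding T_def by blast
    show ?thesis unfolding T_def by (rule unit_equation_reduce[OF sM(1) \<open>z \<noteq> 0\<close> J a(1)[rule_format] a(2) b(1)[rule_format] b(2)])
  qed
  have "z \<in> M \<or> inverse z \<in> M" for z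
  proof (rule ccontr)
    assume z: "\<not> ?thesis"
    then have "z \<noteq> 0" using subring_ambient_0[OF sM(1)] by blast
    obtain n k where nk: "T n z" "T k (inverse z)" using adjoin z by blast
    have "T (max n k) z \<and> T (max n k) (inverse z)" using nk mono by (meson max.cobounded1 max.cobounded2)
    then have "T 0 z \<and> T 0 (inverse z)"
    proof (induction "max n k" arbitrary: n k)
      case 0
      then show ?case by simp
    next
      case (Suc j)
      then have *: "T (Suc j) z" "T (Suc j) (inverse z)" by metis+
      then have "T j z" "T j (inverse z)" using reduce[of j z] reduce[of j "inverse z"] \<open>z \<noteq> 0\<close> by auto
      then show ?case using Suc.hyps(1)[of j j] by simp
    qed
    then have "\<exists>c. (\<forall>i. c i \<in> J) \<and> c (0::nat) = 1" unfolding T_def by simp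
    then obtain c where "c (0::nat) \<in> J" "c 0 = 1" by blast
    then have "1 \<in> J" by simp
    then obtain w where "w \<in> M" "s * w = 1" unfolding J_def by force
    then show False using sM(3) inverse_unique by metis
  qed
  then show ?thesis using sM by blast
qed

section \<open>The rational function field and its places\<close>

text \<open>
  The constants are the image of an algebraically closed field under an embedding \<open>\<iota>\<close>. Working with
  polynomials over the abstract field \<open>'k\<close> makes its factorization into linear factors available.
\<close>

locale rational_function_field =
  fixes \<iota> :: "'k::alg_closed_field \<Rightarrow> 'f::field" and x :: 'f
  assumes \<iota>_add: "\<iota> (a + b) = \<iota> a + \<iota> b" and \<iota>_mult: "\<iota> (a * b) = \<iota> a * \<iota> b" and \<iota>_1: "\<iota> 1 = 1"
    and transcendental_x: "poly (map_poly \<iota> p) x = 0 \<Longrightarrow> p = 0"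
begin

definition K where "K = range \<iota>"

lemma \<iota>_0: "\<iota> 0 = 0" by (metis \<iota>_add add.right_neutral add_left_cancel)

lemma \<iota>_uminus: "\<iota> (- a) = - \<iota> a"
  using \<iota>_add[of a "- a"] \<iota>_0 by (simp add: eq_neg_iff_add_eq_0 add.commute)

lemma \<iota>_diff: "\<iota> (a - b) = \<iota> a - \<iota> b" using \<iota>_add[of a "- b"] \<iota>_uminus by simp

lemma \<iota>_inverse: "\<iota> (inverse a) = inverse (\<iota> a)"
proof (cases "a = 0")
  case False
  then have "\<iota> a * \<iota> (inverse a) = 1" using \<iota>_mult[of a "inverse a"] \<iota>_1 by simp
  then show ?thesis using inverse_unique by metis
qed (simp add: \<iota>_0)

lemma \<iota>_eq_0_iff: "\<iota> a = 0 \<longleftrightarrow> a = 0"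
proof
  assume "\<iota> a = 0"
  show "a = 0"
  proof (rule ccontr)
    assume "a \<noteq> 0"
    then have "\<iota> a * \<iota> (inverse a) = 1" using \<iota>_mult[of a "inverse a"] \<iota>_1 by simp
    then show False using \<open>\<iota> a = 0\<close> by simp
  qed
qed (simp add: \<iota>_0)

lemma \<iota>_power: "\<iota> (a ^ n) = \<iota> a ^ n" by (induction n) (auto simp: \<iota>_1 \<iota>_mult)

lemma \<iota>_sum: "\<iota> (sum f A) = (\<Sum>i\<in>A. \<iota> (f i))"
  by (induction A rule: infinite_finite_induct) (auto simp: \<iota>_0 \<iota>_add)

lemma \<iota>_of_nat: "\<iota> (of_nat n) = of_nat n" by (induction n) (auto simp: \<iota>_0 \<iota>_1 \<iota>_add)

text \<open>
  Evaluation at arbitrary \<open>z\<close> rather than at \<open>x\<close> only: it is applied to \<open>y\<close> as well, to find the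
  residue of \<open>y\<close> at a place.
\<close>

definition evl :: "'f \<Rightarrow> 'k poly \<Rightarrow> 'f" where "evl z p = poly (map_poly \<iota> p) z"

lemma evl_0 [simp]: "evl z 0 = 0" by (simp add: evl_def)

lemma evl_pCons [simp]: "evl z (pCons a p) = \<iota> a + z * evl z p"
  by (simp add: evl_def map_poly_pCons \<iota>_0)

lemma evl_const: "evl z [:a:] = \<iota> a" by simp

lemma evl_1 [simp]: "evl z 1 = 1" using evl_const[of z 1] \<iota>_1 by (simp add: one_pCons)

lemma evl_add: "evl z (p + q) = evl z p + evl z q"
  by (induction p q rule: poly_induct2) (auto simp: \<iota>_add algebra_simps)

lemma evl_smult: "evl z (Polynomial.smult a p) = \<iota> a * evl z p"
  by (induction p) (auto simp: \<iota>_mult algebra_simps)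

lemma evl_mult: "evl z (p * q) = evl z p * evl z q"
  by (induction p) (auto simp: evl_add evl_smult \<iota>_0 algebra_simps)

lemma evl_uminus: "evl z (- p) = - evl z p"
  using evl_smult[of z "-1" p] \<iota>_uminus[of 1] \<iota>_1 by simp

lemma evl_diff: "evl z (p - q) = evl z p - evl z q"
  using evl_add[of z p "- q"] evl_uminus by simp

lemma evl_power: "evl z (p ^ n) = evl z p ^ n" by (induction n) (auto simp: evl_mult)

lemma evl_x_eq_0_iff: "evl x p = 0 \<longleftrightarrow> p = 0" using transcendental_x unfolding evl_def by auto

definition L where "L = {evl x p / evl x q | p q. q \<noteq> 0}"

lemma L_I: "q \<noteq> 0 \<Longrightarrow> evl x p / evl x q \<in> L" unfolding L_def by blast

lemma evl_L: "evl x p \<in> L" using L_I[of 1 p] by simp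

lemma K_L: "K \<subseteq> L" using evl_L evl_const unfolding K_def by (metis image_subsetI)

lemma x_L: "x \<in> L" using evl_L[of "[:0,1:]"] by (simp add: \<iota>_0 \<iota>_1)


lemma K_inverse: "k \<in> K \<Longrightarrow> inverse k \<in> K"
  unfolding K_def by (auto simp flip: \<iota>_inverse)

lemma subfield_L: "subfield L ambient"
  unfolding subfield_ambient_iff subring_ambient_iff
proof (intro conjI ballI)
  show "1 \<in> L" using evl_L[of 1] by simp
next
  fix h assume "h \<in> L"
  then obtain p q where h: "h = evl x p / evl x q" "q \<noteq> 0" unfolding L_def by blast
  show "- h \<in> L" using L_I[of q "- p"] h by (simp add: evl_uminus)
  show "inverse h \<in> L"
  proof (cases "p = 0")
    case True
    then show ?thesis using evl_L[of 0] h by simp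
  next
    case False
    then show ?thesis using L_I[of p q] h by simp
  qed
next
  fix h h' assume "h \<in> L" "h' \<in> L"
  then obtain p q p' q' where h: "h = evl x p / evl x q" "q \<noteq> 0" "h' = evl x p' / evl x q'" "q' \<noteq> 0"
    unfolding L_def by blast
  then have nz: "evl x q \<noteq> 0" "evl x q' \<noteq> 0" "q * q' \<noteq> 0" by (auto simp: evl_x_eq_0_iff)
  show "h * h' \<in> L" using L_I[of "q * q'" "p * p'"] nz h by (simp add: evl_mult)
  show "h + h' \<in> L" using L_I[of "q * q'" "p * q' + p' * q"] nz h
    by (simp add: evl_mult evl_add add_frac_eq)
qed

lemma subring_L: "subring L ambient" using subfield_L unfolding subfield_ambient_iff by blast

lemma evl_in_subring: assumes "subring R ambient" "K \<subseteq> R" "z \<in> R" shows "evl z p \<in> R"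
proof (induction p)
  case 0
  then show ?case using subring_ambient_0[OF assms(1)] by simp
next
  case (pCons a p)
  have "\<iota> a \<in> R" using assms(2) unfolding K_def by blast
  then show ?case using pCons assms unfolding subring_ambient_iff by simp
qed

lemma generate_field_eq_L: "generate_field ambient (K \<union> {x}) = L"
proof -
  interpret field "ambient :: 'f ring" by (rule field_from_type_algebra)
  have "generate_field ambient (K \<union> {x}) \<subseteq> L"
    by (rule generate_field_min_subfield1) (use subfield_L K_L x_L in auto)
  moreover have "L \<subseteq> generate_field ambient (K \<union> {x})" (is "_ \<subseteq> ?G")
  proof
    fix h assume "h \<in> L"
    then obtain p q where h: "h = evl x p * inverse (evl x q)" unfolding L_def divide_inverse by blast
    have G: "subfield ?G ambient" by (rule generate_field_is_subfield) simp
    have "evl x p \<in> ?G" for p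
      by (rule evl_in_subring) (use G in \<open>auto simp: subfield_ambient_iff intro: generate_field.incl\<close>)
    then show "h \<in> ?G" using G unfolding h subfield_ambient_iff subring_ambient_iff by blast
  qed
  ultimately show ?thesis by blast
qed

text \<open>
  The places of \<open>K(x)\<close> are the points of the projective line, \<open>None\<close> being infinity. Every such
  place has the local parameter \<open>loc c\<close>, and \<open>pord c\<close> is its valuation on polynomials.
\<close>

fun loc :: "'k option \<Rightarrow> 'f" where
  "loc None = inverse x"
| "loc (Some a) = x - \<iota> a"

fun pord :: "'k option \<Rightarrow> 'k poly \<Rightarrow> int" where
  "pord None p = - int (Polynomial.degree p)"
| "pord (Some a) p = int (Polynomial.order a p)"

lemma x_nonzero: "x \<noteq> 0"
  using evl_x_eq_0_iff[of "[:0,1:]"] by (simp add: \<iota>_0 \<iota>_1)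

lemma x_notin_K: "x \<notin> K"
proof
  assume "x \<in> K"
  then obtain a where "x = \<iota> a" unfolding K_def by auto
  then have "evl x [:-a,1:] = 0" by (simp add: \<iota>_1 \<iota>_uminus)
  then show False unfolding evl_x_eq_0_iff by simp
qed

lemma loc_nonzero: "loc c \<noteq> 0"
  using x_nonzero x_notin_K unfolding K_def by (cases c) auto

lemma loc_L: "loc c \<in> L"
  using subfield_L x_L K_L subring_ambient_diff[OF subring_L] unfolding subfield_ambient_iff K_def
  by (cases c) auto

end

locale rational_field_place = rational_function_field \<iota> x + field_place K E P
  for \<iota> :: "'k::alg_closed_field \<Rightarrow> 'f::field" and x and E P :: "'f set" +
  assumes L_E: "L \<subseteq> E"
begin

lemma \<iota>_V: "\<iota> a \<in> V" using K_V unfolding K_def by blast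

lemma \<iota>_U: "a \<noteq> 0 \<Longrightarrow> \<iota> a \<in> U"
  using \<iota>_V[of a] \<iota>_V[of "inverse a"] \<iota>_inverse \<iota>_eq_0_iff unfolding U_iff by auto

lemma evl_V: "z \<in> V \<Longrightarrow> evl z p \<in> V"
  using evl_in_subring[OF subring_V] K_V by blast

text \<open>
  Over algebraically closed constants, a polynomial in \<open>z\<close> is a product of linear factors.
\<close>

lemma evl_unit_if_no_root:
  assumes "z \<in> V" "p \<noteq> 0" "\<And>a. poly p a = 0 \<Longrightarrow> z - \<iota> a \<notin> P"
  shows "evl z p \<in> U"
  using assms(2,3)
proof (induction "Polynomial.degree p" arbitrary: p rule: less_induct)
  case less
  show ?case
  proof (cases "Polynomial.degree p = 0")
    case True
    then obtain c where "p = [:c:]" by (elim degree_eq_zeroE)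
    then show ?thesis using \<iota>_U[of c] less.prems by (auto simp del: Diff_iff)
  next
    case False
    then obtain a where a: "poly p a = 0" using alg_closed_imp_poly_has_root[of p] by auto
    then obtain q where q: "p = [:-a,1:] * q" using poly_eq_0_iff_dvd by blast
    then have "q \<noteq> 0" using less.prems by auto
    then have "Polynomial.degree p = Suc (Polynomial.degree q)"
      unfolding q by (subst degree_mult_eq) auto
    then have "evl z q \<in> U" using less.hyps[of q] less.prems \<open>q \<noteq> 0\<close> unfolding q by auto
    moreover have "z - \<iota> a \<in> U" using less.prems(2)[OF a] V_closed(6)[OF assms(1) \<iota>_V] by blast
    moreover have "evl z [:-a,1:] = z - \<iota> a" by (simp add: \<iota>_1 \<iota>_uminus)
    ultimately show ?thesis unfolding q evl_mult using U_mult by simp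
  qed
qed

text \<open>
  If infinity is not the center, then \<open>x\<close> lies in \<open>V\<close>; if no \<open>x - \<iota> a\<close> lies in \<open>P\<close> either, then all
  nonzero polynomials in \<open>x\<close> are units and \<open>V\<close> contains \<open>K(x)\<close>.
\<close>

lemma ex_center:
  assumes "\<not> L \<subseteq> V" shows "\<exists>c. loc c \<in> P"
proof (rule ccontr)
  assume no: "\<nexists>c. loc c \<in> P"
  have "x \<in> V" using no P_if_not_V[of x] x_L L_E by (metis loc.simps(1) subsetD)
  then have "evl x p \<in> U" if "p \<noteq> 0" for p
    using evl_unit_if_no_root[of x p] that no loc.simps(2) by metis
  moreover have "evl x p \<in> V" for p using evl_V \<open>x \<in> V\<close> by blast
  ultimately have "evl x p / evl x q \<in> V" if "q \<noteq> 0" for p q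
    using that V_closed(4) unfolding U_iff divide_inverse by blast
  then show False using assms unfolding L_def by blast
qed

text \<open>
  At \<open>a\<close>, split off the power of \<open>X - a\<close>; the cofactor is congruent to its nonzero value at \<open>a\<close>.
  At infinity the leading term dominates.
\<close>

lemma evl_x_local:
  assumes c: "loc c \<in> P" and p: "p \<noteq> 0"
  shows "\<exists>u\<in>U. evl x p = loc c powi pord c p * u"
proof (cases c)
  case (Some a)
  let ?s = "x - \<iota> a"
  have s: "?s \<in> P" using c Some by simp
  then have "x \<in> V" using V_closed(5)[OF P_V \<iota>_V, of ?s a] by simp
  obtain q where q: "p = [:-a,1:] ^ Polynomial.order a p * q" "\<not> [:-a,1:] dvd q"
    using order_decomp[OF p] by blast
  have "[:-a,1:] dvd q - [:poly q a:]" by (simp flip: poly_eq_0_iff_dvd)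
  then obtain w where w: "q - [:poly q a:] = [:-a,1:] * w" by (elim dvdE)
  have ev_lin: "evl x [:-a,1:] = ?s" by (simp add: \<iota>_1 \<iota>_uminus)
  have "evl x q = evl x ([:poly q a:] + [:-a,1:] * w)" by (simp only: w[symmetric]) simp
  also have "\<dots> = \<iota> (poly q a) + ?s * evl x w"
    unfolding evl_add evl_mult ev_lin by simp
  also have "\<dots> \<in> U"
    using q(2) by (intro U_add_P \<iota>_U P_mult s evl_V \<open>x \<in> V\<close>) (simp add: poly_eq_0_iff_dvd)
  finally have "evl x q \<in> U" .
  moreover have "evl x p = ?s ^ Polynomial.order a p * evl x q"
    by (subst q(1)) (simp only: evl_mult evl_power ev_lin)
  ultimately show ?thesis using Some by auto
next
  case None
  then have s: "inverse x \<in> P" using c by simp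
  have "\<exists>u\<in>U. evl x p = inverse x powi (- int (Polynomial.degree p)) * u" using p
  proof (induction p)
    case (pCons a p)
    show ?case
    proof (cases "p = 0")
      case True
      then show ?thesis using pCons \<iota>_U[of a] by auto
    next
      case False
      then obtain u where u: "u \<in> U" "evl x p = x ^ Polynomial.degree p * u"
        using pCons.IH by (auto simp: power_int_minus power_inverse)
      have "\<iota> a * inverse x ^ Suc (Polynomial.degree p) \<in> P"
        unfolding power_Suc by (intro P_mult' \<iota>_V P_mult s V_closed(7) P_V)
      then have "u + \<iota> a * inverse x ^ Suc (Polynomial.degree p) \<in> U" using U_add_P u by blast
      moreover have "x ^ Suc (Polynomial.degree p) * inverse x ^ Suc (Polynomial.degree p) = 1"
        using x_nonzero by (metis power_mult_distrib right_inverse power_one)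
      then have "evl x (pCons a p) = x ^ Suc (Polynomial.degree p) *
          (u + \<iota> a * inverse x ^ Suc (Polynomial.degree p))"
        by (simp add: u(2) algebra_simps)
      moreover have "inverse x powi (- int (Polynomial.degree (pCons a p))) = x ^ Suc (Polynomial.degree p)"
        using False by (simp add: power_int_def power_inverse nat_add_distrib)
      ultimately show ?thesis by metis
    qed
  qed simp
  then show ?thesis using None by simp
qed

lemma L_local:
  assumes c: "loc c \<in> P" and pq: "p \<noteq> 0" "q \<noteq> 0"
  shows "\<exists>u\<in>U. evl x p / evl x q = loc c powi (pord c p - pord c q) * u"
proof -
  obtain u where u: "u \<in> U" "evl x p = loc c powi pord c p * u" using evl_x_local[OF c pq(1)] by blast
  obtain w where w: "w \<in> U" "evl x q = loc c powi pord c q * w" using evl_x_local[OF c pq(2)] by blast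
  have "evl x p / evl x q = loc c powi (pord c p - pord c q) * (u / w)"
    unfolding u(2) w(2) using loc_nonzero by (simp add: power_int_diff)
  then show ?thesis using U_divide[OF u(1) w(1)] by blast
qed

lemma L_nonzero_cases:
  assumes "h \<in> L" "h \<noteq> 0" obtains p q where "p \<noteq> 0" "q \<noteq> 0" "h = evl x p / evl x q"
proof -
  obtain p q where pq: "h = evl x p / evl x q" "q \<noteq> 0" using assms(1) unfolding L_def by blast
  moreover have "p \<noteq> 0" using pq(1) assms(2) by auto
  ultimately show ?thesis using that by blast
qed

lemma L_powi_local:
  assumes "loc c \<in> P" "h \<in> L" "h \<noteq> 0" shows "\<exists>n. \<exists>u\<in>U. h = loc c powi n * u"
  using L_nonzero_cases[OF assms(2,3)] L_local[OF assms(1)] by metis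

end

context rational_function_field
begin

lemma place_L_discrete:
  assumes Q: "place K L Q"
  obtains c where "loc c \<in> Q" "discrete_place K L Q (loc c)"
proof -
  interpret rational_field_place \<iota> x L Q
    by (intro rational_field_place.intro field_place.intro rational_field_place_axioms.intro
        rational_function_field_axioms Q subfield_L order_refl)
  have "\<not> L \<subseteq> V" using V_E by blast
  then obtain c where c: "loc c \<in> Q" using ex_center by blast
  have "discrete_place K L Q (loc c)"
    by unfold_locales (use c loc_nonzero L_powi_local[OF c] in auto)
  then show ?thesis using that c by blast
qed

lemma place_L_pole_of_x:
  assumes Q: "place K L Q" and neg: "val L Q x < 0"
  shows "inverse x \<in> Q"
proof -
  obtain c where "discrete_place K L Q (loc c)" using place_L_discrete[OF Q] by blast
  then interpret discrete_place K L Q "loc c" .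
  show ?thesis using P_if_not_V[OF x_L] val_V[OF x_L x_nonzero] neg by auto
qed

text \<open>
  The function \<open>x - \<iota> a\<close> is not invertible in \<open>K[x]\<close>, so some valuation ring above \<open>K[x]\<close> has it in
  its maximal ideal.
\<close>

lemma ex_place_over: "\<exists>P. place K UNIV P \<and> loc (Some a) \<in> P"
proof -
  let ?s = "x - \<iota> a"
  have sub: "subring (range (evl x)) ambient" unfolding subring_ambient_iff
    by (auto simp flip: evl_uminus evl_mult evl_add simp: image_iff) (metis evl_1)
  have lin: "evl x [:-a,1:] = ?s" by (simp add: \<iota>_1 \<iota>_uminus)
  have "inverse ?s \<notin> range (evl x)"
  proof
    assume "inverse ?s \<in> range (evl x)"
    then obtain p where p: "inverse ?s = evl x p" by blast
    have "evl x ([:-a,1:] * p - 1) = 0"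
      using p[symmetric] loc_nonzero[of "Some a"] unfolding evl_diff evl_mult lin by simp
    then have "[:-a,1:] * p - 1 = 0" unfolding evl_x_eq_0_iff .
    then have "poly ([:-a,1:] * p - 1) a = 0" by simp
    then show False by simp
  qed
  moreover have "?s \<in> range (evl x)" using lin by (metis rangeI)
  ultimately obtain W where W: "subring W ambient" "range (evl x) \<subseteq> W" "inverse ?s \<notin> W"
    "\<And>z. z \<in> W \<or> inverse z \<in> W"
    using ex_valuation_ring_containing[OF sub] by blast
  have "evl x [:0,1:] = x" by (simp add: \<iota>_0 \<iota>_1)
  then have "x \<in> W" using W(2) by (metis rangeI subsetD)
  moreover have "K \<subseteq> W" using W(2) evl_const[of x] unfolding K_def by (metis image_subsetI rangeI subsetD)
  ultimately have "valuation_ring K UNIV W"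
    unfolding valuation_ring_def using W x_notin_K by blast
  then have "place K UNIV {z \<in> W. \<not> (z \<noteq> 0 \<and> inverse z \<in> W)}" unfolding place_def by blast
  moreover have "?s \<in> W" using lin W(2) by (metis rangeI subsetD)
  ultimately show ?thesis using W(3)
    by (intro exI[of _ "{z \<in> W. \<not> (z \<noteq> 0 \<and> inverse z \<in> W)}"]) auto
qed

end

section \<open>Function fields\<close>

locale function_field = rational_function_field +
  fixes d :: nat
  assumes dimension_L: "ring.dimension ambient d L UNIV"
begin

lemma UNIV_subfield: "subfield UNIV (ambient :: 'b ring)"
  unfolding subfield_ambient_iff subring_ambient_iff by simp

lemma algebraic_bounded: "\<exists>p\<in>poly_over L. p \<noteq> 0 \<and> Polynomial.degree p \<le> d \<and> poly p z = 0"
  using dimension_imp_algebraic_bounded[OF subfield_L dimension_L] .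

lemma rational_field_placeI: "place K UNIV P \<Longrightarrow> rational_field_place \<iota> x UNIV P"
  by (intro rational_field_place.intro field_place.intro rational_field_place_axioms.intro
      rational_function_field_axioms UNIV_subfield subset_UNIV)

text \<open>
  A valuation ring is integrally closed, so if it contained \<open>K(x)\<close> it would contain everything. The
  comparison of two terms of equal value replaces a monic equation here: their quotient exhibits a
  power of \<open>z\<close> as a unit.
\<close>

lemma L_not_subset_V:
  assumes "place K UNIV P" shows "\<not> L \<subseteq> ring_of_place UNIV P"
proof
  interpret rational_field_place \<iota> x UNIV P using rational_field_placeI[OF assms] .
  assume LV: "L \<subseteq> V"
  have LU: "h \<in> U" if "h \<in> L" "h \<noteq> 0" for h
    using that LV subfield_L unfolding U_iff subfield_ambient_iff by blast
  obtain z where z: "z \<notin> V" using V_E by blast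
  then have z0: "z \<noteq> 0" using V_closed(2) by blast
  obtain p where p: "p \<in> poly_over L" "p \<noteq> 0" "poly p z = 0" using algebraic_bounded by blast
  let ?c = "Polynomial.coeff p"
  let ?I = "{..Polynomial.degree p}"
  have "(\<Sum>i\<in>?I. ?c i * z ^ i) = 0" using p(3) by (simp add: poly_altdef)
  moreover have "\<exists>i\<in>?I. ?c i * z ^ i \<noteq> 0"
    using p(2) z0 by (intro bexI[of _ "Polynomial.degree p"]) auto
  ultimately obtain i j where ij: "i \<noteq> j" "?c i * z ^ i \<noteq> 0" "?c j * z ^ j \<noteq> 0"
    "?c i * z ^ i / (?c j * z ^ j) \<in> U"
    using vanishing_sum_two_associated_terms[of ?I "\<lambda>i. ?c i * z ^ i"] by auto
  have main: False if ij: "i > j" "?c i \<noteq> 0" "?c j \<noteq> 0" "?c i * z ^ i / (?c j * z ^ j) \<in> U" for i j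
  proof -
    have c: "?c i \<in> U" "?c j \<in> U" using LU p(1) ij unfolding poly_over_def by auto
    have "i = j + (i - j)" using ij(1) by simp
    then have "z ^ i = z ^ j * z ^ (i - j)" by (metis power_add)
    then have "z ^ (i - j) = ?c i * z ^ i / (?c j * z ^ j) * (?c j / ?c i)"
      using z0 ij by (simp add: field_simps)
    also have "\<dots> \<in> U" by (intro U_mult U_divide ij c)
    finally show False using V_if_power_V[of z "i - j"] ij(1) z by auto
  qed
  have "?c j * z ^ j / (?c i * z ^ i) \<in> U" using U_inverse[OF ij(4)] by simp
  then show False using main[of i j] main[of j i] ij by (cases i j rule: linorder_cases) auto
qed

lemma ex_loc_in_place: "place K UNIV P \<Longrightarrow> \<exists>c. loc c \<in> P"
  using rational_field_place.ex_center[OF rational_field_placeI] L_not_subset_V by blast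

lemma place_discrete: 
  assumes P: "place K UNIV P" shows "\<exists>t. discrete_place K UNIV P t"
proof -
  interpret rational_field_place \<iota> x UNIV P using rational_field_placeI[OF P] .
  obtain c where c: "loc c \<in> P" using ex_loc_in_place[OF P] by blast
  show ?thesis
    by (rule discrete_if_algebraic_bounded[OF c loc_nonzero, of L d])
      (use L_powi_local[OF c] algebraic_bounded in auto)
qed

lemma val_L:
  assumes P: "place K UNIV P" and c: "loc c \<in> P" and pq: "p \<noteq> 0" "q \<noteq> 0"
  shows "val UNIV P (evl x p / evl x q) = (pord c p - pord c q) * val UNIV P (loc c)"
proof -
  interpret rational_field_place \<iota> x UNIV P using rational_field_placeI[OF P] .
  obtain t where "discrete_place K UNIV P t" using place_discrete[OF P] by blast
  then interpret D: discrete_place K UNIV P t .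
  obtain u where u: "u \<in> U" "evl x p / evl x q = loc c powi (pord c p - pord c q) * u"
    using L_local[OF c pq] by blast
  show ?thesis unfolding u(2)
    using D.val_mult[of "loc c powi (pord c p - pord c q)" u] D.val_powi[of "loc c"] D.val_U[OF u(1)]
      loc_nonzero[of c] U_nonzero[OF u(1)] by simp
qed

end

section \<open>Monic division and root multiplicities\<close>

text \<open>
  As \<open>X\<^sup>m - c\<close> is monic, the division needs no inverses in \<open>R\<close>.
\<close>

lemma poly_over_divide_by_power_minus_const:
  assumes R: "subring R (ambient :: 'f::field ring)" and c: "c \<in> R" and m: "m > 0" and p: "p \<in> poly_over R"
  shows "\<exists>q\<in>poly_over R. \<exists>w\<in>poly_over R.
    p = q * (Polynomial.monom 1 m - [:c:]) + w \<and> Polynomial.degree w < m"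
  using p
proof (induction p)
  case 0
  then show ?case using poly_over_0[OF R] m by (intro bexI[of _ 0]) auto
next
  case (pCons a p)
  let ?M = "Polynomial.monom 1 m - [:c:]"
  obtain q w where q: "q \<in> poly_over R" "w \<in> poly_over R" "p = q * ?M + w" "Polynomial.degree w < m"
    using pCons by auto
  have a: "a \<in> R" using pCons by simp
  \<comment> \<open>The coefficient that would give \<open>pCons a w\<close> degree \<open>m\<close>; it may be \<open>0\<close>.\<close>
  define l where "l = Polynomial.coeff w (m - 1)"
  have l: "l \<in> R" using q(2) unfolding l_def poly_over_def by blast
  have M: "?M \<in> poly_over R"
    using R c unfolding subring_ambient_iff by (intro poly_over_diff poly_over_monom poly_over_const R) auto
  define w' where "w' = pCons a w - Polynomial.smult l ?M"
  define q' where "q' = pCons l q"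
  have sm: "Polynomial.smult l ?M \<in> poly_over R"
    using poly_over_mult[OF R poly_over_const[OF R l] M] by simp
  have "w' \<in> poly_over R" unfolding w'_def using sm q(2) a by (intro poly_over_diff R) auto
  moreover have "q' \<in> poly_over R" unfolding q'_def using l q by simp
  moreover have "pCons a p = q' * ?M + w'"
    unfolding q'_def w'_def q(3) mult_pCons_left by simp
  moreover have "Polynomial.degree w' < m"
  proof (rule degree_lessI)
    show "w' \<noteq> 0 \<or> m > 0" using m by simp
    show "\<forall>k\<ge>m. Polynomial.coeff w' k = 0"
    proof (intro allI impI)
      fix k assume k: "k \<ge> m"
      show "Polynomial.coeff w' k = 0"
      proof (cases "k = m")
        case True
        then show ?thesis using m unfolding w'_def l_def
          by (auto simp: coeff_pCons split: nat.splits)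
      next
        case False
        then have "Polynomial.coeff w (k - 1) = 0" using k q(4) by (intro coeff_eq_0) auto
        then show ?thesis using False k m unfolding w'_def
          by (auto simp: coeff_pCons split: nat.splits)
      qed
    qed
  qed
  ultimately show ?case by blast
qed

text \<open>
  The difference of degrees is the sum of the orders of \<open>n / d\<close> over all points, and the orders
  away from \<open>a\<close> are non-negative. Removing the common linear factors one at a time avoids forming
  the sum.
\<close>

lemma order_diff_le_degree_diff:
  fixes n d :: "'k::alg_closed_field poly"
  assumes "n \<noteq> 0" "d \<noteq> 0" "\<And>b. b \<noteq> a \<Longrightarrow> Polynomial.order b d \<le> Polynomial.order b n"
  shows "int (Polynomial.order a n) - int (Polynomial.order a d) \<le> int (Polynomial.degree n) - int (Polynomial.degree d)"
  using assms
proof (induction "Polynomial.degree d" arbitrary: n d rule: less_induct)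
  case less
  show ?case
  proof (cases "\<exists>b. b \<noteq> a \<and> poly d b = 0")
    case True
    then obtain b where b: "b \<noteq> a" "poly d b = 0" by blast
    then have "Polynomial.order b d > 0" using less.prems(2) order_root by blast
    then have "Polynomial.order b n > 0" using less.prems(3)[OF b(1)] by simp
    then have "poly n b = 0" using order_root by blast
    then obtain n1 where n1: "n = [:-b,1:] * n1" using poly_eq_0_iff_dvd by blast
    obtain d1 where d1: "d = [:-b,1:] * d1" using b(2) poly_eq_0_iff_dvd by blast
    have nz: "n1 \<noteq> 0" "d1 \<noteq> 0" using less.prems n1 d1 by auto
    have deg: "Polynomial.degree n = Suc (Polynomial.degree n1)" "Polynomial.degree d = Suc (Polynomial.degree d1)"
      unfolding n1 d1 using nz by (simp_all add: degree_mult_eq del: mult_pCons_left)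
    have ord: "Polynomial.order c n = Polynomial.order c [:-b,1:] + Polynomial.order c n1"
      "Polynomial.order c d = Polynomial.order c [:-b,1:] + Polynomial.order c d1" for c
      using less.prems(1,2) unfolding n1 d1 by (metis order_mult)+
    have "Polynomial.order c d1 \<le> Polynomial.order c n1" if "c \<noteq> a" for c
      using less.prems(3)[OF that] ord[of c] by simp
    then have "int (Polynomial.order a n1) - int (Polynomial.order a d1)
        \<le> int (Polynomial.degree n1) - int (Polynomial.degree d1)"
      using less.hyps[of d1 n1] nz deg by simp
    then show ?thesis using ord[of a] deg by simp
  next
    case False
    obtain q where q: "d = [:-a,1:] ^ Polynomial.order a d * q" "\<not> [:-a,1:] dvd q"
      using order_decomp[OF less.prems(2)] by blast
    have "poly q b \<noteq> 0" for b
    proof (cases "b = a")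
      case True then show ?thesis using q(2) by (simp add: poly_eq_0_iff_dvd)
    next
      case b: False
      then have "poly d b \<noteq> 0" using False by blast
      then show ?thesis by (subst (asm) q(1)) auto
    qed
    then have "Polynomial.degree q = 0" using alg_closed_imp_poly_has_root[of q] by blast
    moreover have "q \<noteq> 0" using q less.prems(2) by auto
    ultimately have "Polynomial.degree d = Polynomial.order a d"
      by (subst q(1)) (simp add: degree_mult_eq degree_power_eq)
    then show ?thesis using order_degree[OF less.prems(1), of a] by simp
  qed
qed

section \<open>Roots of unity\<close>

lemma degree_monom_minus_1:
  "n > 0 \<Longrightarrow> Polynomial.degree (Polynomial.monom 1 n - 1 :: 'a::comm_ring_1 poly) = n"
  using degree_add_eq_left[of "- 1" "Polynomial.monom (1::'a) n"] by (simp add: Polynomial.degree_monom_eq)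

text \<open>
  The polynomial \<open>X\<^sup>m - 1\<close> splits, and a double root would be a root of \<open>m X\<^bsup>m-1\<^esup>\<close>, that is, \<open>0\<close>.
\<close>

lemma card_roots_of_unity:
  fixes m :: nat
  assumes m: "m > 0" "of_nat m \<noteq> (0 :: 'k::alg_closed_field)"
  shows "finite {b::'k. b ^ m = 1}" "card {b::'k. b ^ m = 1} = m"
proof -
  let ?p = "Polynomial.monom 1 m - 1 :: 'k poly"
  have deg: "Polynomial.degree ?p = m"
    using m(1) by (rule degree_monom_minus_1)
  have "Polynomial.coeff ?p m = 1" using m(1) by (simp add: Polynomial.coeff_1)
  then have lc: "Polynomial.lead_coeff ?p = 1" unfolding deg .
  then have p0: "?p \<noteq> 0" by (metis leading_coeff_0_iff zero_neq_one)
  have roots: "{b. poly ?p b = 0} = {b. b ^ m = 1}" by (auto simp: poly_monom)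
  show fin: "finite {b::'k. b ^ m = 1}" unfolding roots[symmetric] by (rule poly_roots_finite[OF p0])
  obtain A where A: "size A = Polynomial.degree ?p" "?p = (\<Prod>a\<in>#A. [:-a,1:])"
    using alg_closed_imp_factorization[OF p0] lc by auto
  have cnt: "count A a \<le> 1" for a
  proof (rule ccontr)
    assume "\<not> count A a \<le> 1"
    then have "{#a, a#} \<subseteq># A" by (auto simp: subseteq_mset_def)
    then obtain B where "A = {#a, a#} + B" by (metis subset_mset.add_diff_inverse)
    then have p: "?p = [:-a,1:] * ([:-a,1:] * (\<Prod>a\<in>#B. [:-a,1:]))" using A(2) by (simp add: mult.assoc)
    then have "poly ?p a = poly ([:-a,1:] * ([:-a,1:] * (\<Prod>a\<in>#B. [:-a,1:]))) a" by (simp only:)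
    then have "a ^ m = 1" by (simp add: poly_monom)
    have "poly (pderiv ?p) a = poly (pderiv ([:-a,1:] * ([:-a,1:] * (\<Prod>a\<in>#B. [:-a,1:])))) a"
      by (simp only: p)
    also have "\<dots> = 0" unfolding pderiv_mult by simp
    also have "poly (pderiv ?p) a = of_nat m * a ^ (m - 1)"
      by (simp add: pderiv_diff pderiv_monom poly_monom)
    finally have "a = 0" using m by auto
    then show False using \<open>a ^ m = 1\<close> m(1) by (simp add: power_0_left)
  qed
  have "set_mset A = {b. poly ?p b = 0}" unfolding A(2) by (auto simp: poly_prod_mset prod_mset_zero_iff)
  moreover have "size A = card (set_mset A)"
  proof -
    have "count A a = 1" if "a \<in># A" for a using cnt[of a] that by (metis count_greater_eq_one_iff le_antisym)
    then show ?thesis unfolding size_multiset_overloaded_eq by simp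
  qed
  ultimately show "card {b::'k. b ^ m = 1} = m" using A(1) deg roots by simp
qed

text \<open>
  There are more \<open>m\<close>-th roots of unity than roots of \<open>X\<^sup>i - 1\<close> for \<open>i = j mod m\<close>, so some \<open>c\<close> among
  them has \<open>c\<^sup>j \<noteq> 1\<close>. Multiplication by \<open>c\<close> permutes them and multiplies the sum by \<open>c\<^sup>j\<close>.
\<close>

lemma sum_roots_of_unity_power:
  fixes m j :: nat
  assumes m: "m > 0" "of_nat m \<noteq> (0 :: 'k::alg_closed_field)" and j: "\<not> m dvd j"
  shows "(\<Sum>b\<in>{b::'k. b ^ m = 1}. b ^ j) = 0"
proof -
  let ?W = "{b::'k. b ^ m = 1}"
  define i where "i = j mod m"
  have i: "0 < i" "i < m" using j m unfolding i_def by (auto simp: mod_greater_zero_iff_not_dvd)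
  have "\<exists>c\<in>?W. c ^ i \<noteq> 1"
  proof (rule ccontr)
    assume "\<not> ?thesis"
    then have sub: "?W \<subseteq> {b. poly (Polynomial.monom 1 i - 1 :: 'k poly) b = 0}" by (auto simp: poly_monom)
    have deg: "Polynomial.degree (Polynomial.monom 1 i - 1 :: 'k poly) = i"
      using i(1) by (rule degree_monom_minus_1)
    then have nz: "(Polynomial.monom 1 i - 1 :: 'k poly) \<noteq> 0" using i(1) by (metis Polynomial.degree_0 less_irrefl)
    have "card ?W \<le> i"
      using card_mono[OF poly_roots_finite[OF nz] sub] card_poly_roots_bound[OF nz] deg by simp
    then show False using card_roots_of_unity(2)[OF m] i by simp
  qed
  then obtain c :: 'k where c: "c ^ m = 1" "c ^ i \<noteq> 1" by blast
  have "c ^ j = c ^ (m * (j div m) + i)" unfolding i_def by simp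
  also have "\<dots> = c ^ i" using c(1) by (simp add: power_add power_mult)
  finally have cj: "c ^ j \<noteq> 1" using c(2) by simp
  have c0: "c \<noteq> 0" using c(1) m(1) by (auto simp: power_0_left)
  have "(\<Sum>b\<in>?W. b ^ j) = (\<Sum>b\<in>?W. (c * b) ^ j)"
    by (rule sum.reindex_bij_witness[of _ "\<lambda>b. c * b" "\<lambda>b. b / c"])
      (use c c0 in \<open>auto simp: power_mult_distrib power_divide\<close>)
  also have "\<dots> = c ^ j * (\<Sum>b\<in>?W. b ^ j)" by (simp add: power_mult_distrib sum_distrib_left)
  finally have "(c ^ j - 1) * (\<Sum>b\<in>?W. b ^ j) = 0" by (simp add: algebra_simps)
  then show ?thesis using cj by simp
qed

section \<open>Kummer extensions\<close>

text \<open>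
  The conditions on \<open>g\<close> make its order prime to \<open>m\<close> at each of its zeros and at infinity; total
  ramification over these points rests on that.
\<close>

locale kummer_extension = function_field \<iota> x d
  for \<iota> :: "'k::alg_closed_field \<Rightarrow> 'f::field" and x :: 'f and d :: nat +
  fixes m :: nat and g :: "'k poly" and y :: 'f
  assumes m: "m \<ge> 2" "of_nat m \<noteq> (0::'k)"
    and order_g: "\<And>a. Polynomial.order a g \<le> 1" and coprime_m_degree: "coprime m (Polynomial.degree g)"
    and g_nonzero: "g \<noteq> 0"
    and y_power: "y ^ m = evl x g"
    and generated: "\<exists>p\<in>poly_over L. poly p y = z"
begin

lemma y_nonzero: "y \<noteq> 0"
  using y_power g_nonzero m(1) evl_x_eq_0_iff[of g] by (auto simp: power_0_left)

lemma reduced_division: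
  assumes "p \<in> poly_over L"
  obtains q w where "q \<in> poly_over L" "w \<in> poly_over L" "Polynomial.degree w < m"
    "p = q * (Polynomial.monom 1 m - [:evl x g:]) + w"
proof -
  have "m > 0" using m(1) by simp
  from poly_over_divide_by_power_minus_const[OF subring_L evl_L this assms, of g]
  show ?thesis using that by blast
qed

lemma reduced_representation:
  obtains p where "p \<in> poly_over L" "Polynomial.degree p < m" "poly p y = z"
proof -
  obtain p where p: "p \<in> poly_over L" "poly p y = z" using generated by blast
  obtain q w where w: "w \<in> poly_over L" "Polynomial.degree w < m"
    "p = q * (Polynomial.monom 1 m - [:evl x g:]) + w" using reduced_division[OF p(1)] by metis
  have "poly w y = z" using p(2) unfolding w(3) by (simp add: poly_monom y_power)
  then show ?thesis using that w by blast
qed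

lemma val_y:
  assumes P: "place K UNIV P" and c: "loc c \<in> P"
  shows "int m * val UNIV P y = pord c g * val UNIV P (loc c)"
proof -
  obtain t where "discrete_place K UNIV P t" using place_discrete[OF P] by blast
  then interpret D: discrete_place K UNIV P t .
  have "int m * val UNIV P y = val UNIV P (evl x g / evl x 1)"
    using D.val_power[of y m] y_nonzero y_power by simp
  also have "\<dots> = pord c g * val UNIV P (loc c)"
    using val_L[OF P c g_nonzero one_neq_zero] by (cases c) auto
  finally show ?thesis .
qed

lemma val_L_multiple:
  assumes P: "place K UNIV P" and c: "loc c \<in> P" and h: "h \<in> L" "h \<noteq> 0"
  shows "\<exists>n. val UNIV P h = n * val UNIV P (loc c)"
proof -
  interpret rational_field_place \<iota> x UNIV P using rational_field_placeI[OF P] .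
  show ?thesis using L_nonzero_cases[OF h] val_L[OF P c] by metis
qed

text \<open>
  Put \<open>w = pord c g\<close>. From \<open>m v(y) = w v(s)\<close> with \<open>m\<close> and \<open>w\<close> coprime it follows that
  \<open>v(s) = m e\<close> and \<open>v(y) = w e\<close>. The values of the terms \<open>h\<^sub>k y\<^sup>k\<close> are then \<open>e\<close> times numbers that
  are distinct modulo \<open>m\<close>, so no cancellation occurs and every value is a multiple of \<open>e\<close>. As the
  valuation is normalized, \<open>e = 1\<close>: the place is totally ramified.
\<close>

lemma ramified_place:
  assumes P: "place K UNIV P" and c: "loc c \<in> P" and cop: "coprime (int m) (pord c g)"
  shows val_loc_ramified: "val UNIV P (loc c) = int m"
    and val_y_ramified: "val UNIV P y = pord c g"
    and val_poly_ramified: "\<And>p. p \<in> poly_over L \<Longrightarrow> p \<noteq> 0 \<Longrightarrow> Polynomial.degree p < m \<Longrightarrow>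
      poly p y \<noteq> 0 \<and> val UNIV P (poly p y) =
        Min ((\<lambda>k. val UNIV P (Polynomial.coeff p k) + int k * pord c g) ` {k. Polynomial.coeff p k \<noteq> 0})"
proof -
  obtain t where "discrete_place K UNIV P t" using place_discrete[OF P] by blast
  then interpret D: discrete_place K UNIV P t .
  let ?v = "val UNIV P"
  have "?v (loc c) > 0" using D.val_P[of "loc c"] loc_nonzero c by simp
  moreover have "int m dvd ?v (loc c)"
    using val_y[OF P c] cop by (metis coprime_dvd_mult_right_iff dvd_triv_left)
  then obtain e where e: "?v (loc c) = int m * e" by (elim dvdE)
  ultimately have "e > 0" using m(1) by (simp add: zero_less_mult_iff)
  have vy: "?v y = pord c g * e" using val_y[OF P c] e m(1) by simp
  have expansion: "poly p y \<noteq> 0 \<and> ?v (poly p y) =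
        Min ((\<lambda>k. ?v (Polynomial.coeff p k) + int k * ?v y) ` {k. Polynomial.coeff p k \<noteq> 0})
      \<and> e dvd ?v (poly p y)"
    if p: "p \<in> poly_over L" "p \<noteq> 0" "Polynomial.degree p < m" for p
  proof -
    let ?I = "{k. Polynomial.coeff p k \<noteq> 0}"
    let ?f = "\<lambda>k. Polynomial.coeff p k * y ^ k"
    have I: "?I \<subseteq> {..Polynomial.degree p}" using le_degree by auto
    then have fin: "finite ?I" by (rule finite_subset) simp
    have ne: "?I \<noteq> {}" using p(2) by (auto intro!: exI[of _ "Polynomial.degree p"])
    have vf: "?v (?f k) = ?v (Polynomial.coeff p k) + int k * ?v y" if "k \<in> ?I" for k
      using that y_nonzero D.val_mult[of "Polynomial.coeff p k" "y ^ k"] D.val_power[of y k] by simp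
    have "\<exists>n. ?v (Polynomial.coeff p k) = n * ?v (loc c)" if "k \<in> ?I" for k
      using val_L_multiple[OF P c, of "Polynomial.coeff p k"] p(1) that unfolding poly_over_def by simp
    then obtain n where n: "\<And>k. k \<in> ?I \<Longrightarrow> ?v (Polynomial.coeff p k) = n k * ?v (loc c)" by metis
    have vf': "?v (?f k) = e * (int m * n k + int k * pord c g)" if "k \<in> ?I" for k
      unfolding vf[OF that] n[OF that] e vy by (simp add: algebra_simps)
    have inj: "inj_on (\<lambda>k. ?v (?f k)) ?I"
    proof (rule inj_onI)
      fix k k' assume k: "k \<in> ?I" "k' \<in> ?I" "?v (?f k) = ?v (?f k')"
      then have "int m * n k + int k * pord c g = int m * n k' + int k' * pord c g"
        using \<open>e > 0\<close> unfolding vf'[OF k(1)] vf'[OF k(2)] by simp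
      then have "(int k - int k') * pord c g = int m * (n k' - n k)" by (simp add: algebra_simps)
      then have "int m dvd int k - int k'"
        using cop by (metis coprime_dvd_mult_left_iff dvd_triv_left)
      moreover have "k < m" "k' < m" using k I p(3) by auto
      then have "\<bar>int k - int k'\<bar> < int m" by linarith
      ultimately show "k = k'" using zdvd_imp_le[of "int m" "\<bar>int k - int k'\<bar>"] by auto
    qed
    have sum: "poly p y = sum ?f ?I" unfolding poly_altdef
      by (rule sum.mono_neutral_right) (use I in auto)
    have main: "sum ?f ?I \<noteq> 0" "?v (sum ?f ?I) = Min ((\<lambda>k. ?v (?f k)) ` ?I)"
      using D.val_sum_distinct[OF fin ne _ inj] y_nonzero by auto
    have "Min ((\<lambda>k. ?v (?f k)) ` ?I) \<in> (\<lambda>k. ?v (?f k)) ` ?I" using fin ne by simp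
    then obtain k where "k \<in> ?I" "Min ((\<lambda>k. ?v (?f k)) ` ?I) = ?v (?f k)" by blast
    then have "e dvd ?v (poly p y)" unfolding sum main(2) using vf' by simp
    moreover have "(\<lambda>k. ?v (?f k)) ` ?I = (\<lambda>k. ?v (Polynomial.coeff p k) + int k * ?v y) ` ?I"
      by (rule image_cong[OF refl]) (rule vf)
    ultimately show ?thesis using main unfolding sum by simp
  qed
  obtain p where p: "p \<in> poly_over L" "Polynomial.degree p < m" "poly p y = t"
    using reduced_representation by blast
  have "p \<noteq> 0" using p(3) D.t_nonzero by auto
  then have "e dvd 1" using expansion[OF p(1) _ p(2)] p(3) D.val_t by simp
  then have "e = 1" using \<open>e > 0\<close> by simp
  then show "?v (loc c) = int m" "?v y = pord c g" using e vy by auto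
  then show "\<And>p. p \<in> poly_over L \<Longrightarrow> p \<noteq> 0 \<Longrightarrow> Polynomial.degree p < m \<Longrightarrow>
      poly p y \<noteq> 0 \<and> ?v (poly p y) =
        Min ((\<lambda>k. ?v (Polynomial.coeff p k) + int k * pord c g) ` {k. Polynomial.coeff p k \<noteq> 0})"
    using expansion by simp
qed

text \<open>
  All values at such a place are computed from the expansion in powers of \<open>y\<close> by a formula that
  involves only \<open>c\<close>.
\<close>

lemma ramified_place_unique:
  assumes P: "place K UNIV P" "loc c \<in> P" and P': "place K UNIV P'" "loc c \<in> P'"
    and cop: "coprime (int m) (pord c g)"
  shows "P = P'"
proof -
  obtain t where "discrete_place K UNIV P t" using place_discrete[OF P(1)] by blast
  then interpret D: discrete_place K UNIV P t .
  obtain t' where "discrete_place K UNIV P' t'" using place_discrete[OF P'(1)] by blast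
  then interpret D': discrete_place K UNIV P' t' .
  interpret rational_field_place \<iota> x UNIV P using rational_field_placeI[OF P(1)] .
  have vL: "val UNIV P h = val UNIV P' h" if h: "h \<in> L" "h \<noteq> 0" for h
  proof -
    obtain p q where "p \<noteq> 0" "q \<noteq> 0" "h = evl x p / evl x q" using L_nonzero_cases[OF h] by blast
    then show ?thesis
      using val_L[OF P] val_L[OF P'] val_loc_ramified[OF P cop] val_loc_ramified[OF P' cop] by simp
  qed
  have v: "val UNIV P z = val UNIV P' z" if z: "z \<noteq> 0" for z
  proof -
    obtain p where p: "p \<in> poly_over L" "Polynomial.degree p < m" "poly p y = z"
      using reduced_representation by blast
    have p0: "p \<noteq> 0" using p(3) z by auto
    have "val UNIV P (Polynomial.coeff p k) = val UNIV P' (Polynomial.coeff p k)"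
      if "Polynomial.coeff p k \<noteq> 0" for k
      using that vL p(1) unfolding poly_over_def by blast
    then have "(\<lambda>k. val UNIV P (Polynomial.coeff p k) + int k * pord c g) ` {k. Polynomial.coeff p k \<noteq> 0}
      = (\<lambda>k. val UNIV P' (Polynomial.coeff p k) + int k * pord c g) ` {k. Polynomial.coeff p k \<noteq> 0}"
      by (intro image_cong) auto
    then show ?thesis
      using val_poly_ramified[OF P cop p(1) p0 p(2)] val_poly_ramified[OF P' cop p(1) p0 p(2)] p(3) by simp
  qed
  have "z \<in> P \<longleftrightarrow> z \<in> P'" for z
    using v[of z] D.val_P[of z] D'.val_P[of z] D.zero_P D'.zero_P by (cases "z = 0") auto
  then show ?thesis by blast
qed

lemma degree_g_pos: "Polynomial.degree g > 0"
  using coprime_m_degree m(1) by (cases "Polynomial.degree g = 0") auto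

lemma coprime_infinity: "coprime (int m) (pord None g)"
  using coprime_m_degree by simp

lemma order_root_g: "poly g a = 0 \<Longrightarrow> Polynomial.order a g = 1"
  using order_g[of a] order_root[of g a] g_nonzero by (metis One_nat_def le_Suc_eq le_zero_eq)

lemma coprime_root: "poly g a = 0 \<Longrightarrow> coprime (int m) (pord (Some a) g)"
  using order_root_g[of a] by simp

text \<open>
  At a place over a root of \<open>g\<close> the value of a nonzero combination is the least value of its terms;
  in particular the combination does not vanish.
\<close>

lemma linear_independence:
  assumes "p \<in> poly_over L" "Polynomial.degree p < m" "poly p y = 0" shows "p = 0"
proof (rule ccontr)
  assume "p \<noteq> 0"
  obtain a where a: "poly g a = 0" using alg_closed_imp_poly_has_root[OF degree_g_pos] by blast
  obtain P where "place K UNIV P" "loc (Some a) \<in> P" using ex_place_over by blast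
  then show False using val_poly_ramified[OF _ _ coprime_root[OF a] assms(1) \<open>p \<noteq> 0\<close> assms(2)] assms(3) by blast
qed

section \<open>Conjugation by roots of unity\<close>

text \<open>
  The endomorphism \<open>y \<mapsto> \<iota> b y\<close> over \<open>K(x)\<close>, for an \<open>m\<close>-th root of unity \<open>b\<close>. The choice of a
  representing polynomial is immaterial by \<open>conjugate_poly\<close>.
\<close>

definition conjugate :: "'k \<Rightarrow> 'f \<Rightarrow> 'f" where
  "conjugate b z = poly (SOME p. p \<in> poly_over L \<and> poly p y = z) (\<iota> b * y)"

text \<open>
  A polynomial that vanishes at \<open>y\<close> is a multiple of \<open>X\<^sup>m - g(x)\<close> by linear independence, hence it
  vanishes at \<open>\<iota> b y\<close> too.
\<close>

lemma conjugate_poly: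
  assumes b: "b ^ m = 1" and p: "p \<in> poly_over L" shows "conjugate b (poly p y) = poly p (\<iota> b * y)"
proof -
  define q where "q = (SOME q. q \<in> poly_over L \<and> poly q y = poly p y)"
  have q: "q \<in> poly_over L \<and> poly q y = poly p y"
    unfolding q_def by (rule someI[of _ p]) (use p in simp)
  obtain a w where w: "w \<in> poly_over L" "Polynomial.degree w < m"
    "p - q = a * (Polynomial.monom 1 m - [:evl x g:]) + w"
    using reduced_division[OF poly_over_diff[OF subring_L p, of q]] q by metis
  have "poly (p - q) y = poly w y" unfolding w(3) by (simp add: poly_monom y_power)
  then have "w = 0" using linear_independence[OF w(1,2)] q by simp
  have "\<iota> b ^ m = 1" using b \<iota>_power[of b m] \<iota>_1 by simp
  then have "poly (p - q) (\<iota> b * y) = 0" unfolding w(3) \<open>w = 0\<close>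
    by (simp add: poly_monom power_mult_distrib y_power)
  then show ?thesis unfolding conjugate_def q_def[symmetric] by simp
qed

context
  fixes b :: 'k assumes b: "b ^ m = 1"
begin

lemma conjugate_L: "h \<in> L \<Longrightarrow> conjugate b h = h"
  using conjugate_poly[OF b, of "[:h:]"] poly_over_const[OF subring_L] by simp

lemma conjugate_y: "conjugate b y = \<iota> b * y"
  using conjugate_poly[OF b, of "[:0,1:]"] subring_ambient_0[OF subring_L] evl_L[of 1] poly_over_0[OF subring_L]
  by simp

lemma conjugate_mult: "conjugate b (z * w) = conjugate b z * conjugate b w"
proof -
  obtain p q where "p \<in> poly_over L" "poly p y = z" "q \<in> poly_over L" "poly q y = w" 
    using generated by metis
  then show ?thesis using conjugate_poly[OF b] poly_over_mult[OF subring_L, of p q] by (metis poly_mult)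
qed

lemma conjugate_add: "conjugate b (z + w) = conjugate b z + conjugate b w"
proof -
  obtain p q where "p \<in> poly_over L" "poly p y = z" "q \<in> poly_over L" "poly q y = w" 
    using generated by metis
  then show ?thesis using conjugate_poly[OF b] poly_over_add[OF subring_L, of p q] by (metis poly_add)
qed

lemma conjugate_K: "k \<in> K \<Longrightarrow> conjugate b k = k" using conjugate_L K_L by blast

lemma conjugate_0: "conjugate b 0 = 0" and conjugate_1: "conjugate b 1 = 1"
  using conjugate_L[OF evl_L[of 0]] conjugate_L[OF evl_L[of 1]] by simp_all

lemma conjugate_uminus: "conjugate b (- z) = - conjugate b z"
  using conjugate_add[of z "- z"] conjugate_0 by (simp add: eq_neg_iff_add_eq_0 add.commute)

lemma conjugate_eq_0_iff: "conjugate b z = 0 \<longleftrightarrow> z = 0"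
proof
  assume "conjugate b z = 0"
  show "z = 0"
  proof (rule ccontr)
    assume "z \<noteq> 0"
    then have "conjugate b z * conjugate b (inverse z) = 1" using conjugate_mult[of z "inverse z"] conjugate_1 by simp
    then show False using \<open>conjugate b z = 0\<close> by simp
  qed
qed (simp add: conjugate_0)

lemma conjugate_inverse: "conjugate b (inverse z) = inverse (conjugate b z)"
proof (cases "z = 0")
  case False
  then have "conjugate b z * conjugate b (inverse z) = 1" using conjugate_mult[of z "inverse z"] conjugate_1 by simp
  then show ?thesis using inverse_unique by metis
qed (simp add: conjugate_0)

lemma conjugate_place:
  assumes P: "place K UNIV P"
  shows "place K UNIV (conjugate b -` P)" "ring_of_place UNIV (conjugate b -` P) = conjugate b -` ring_of_place UNIV P"
proof -
  interpret rational_field_place \<iota> x UNIV P using rational_field_placeI[OF P] .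
  obtain c where c: "loc c \<in> P" using ex_loc_in_place[OF P] by blast
  have "inverse (loc c) \<notin> V" using c loc_nonzero P_iff by blast
  have "loc c \<notin> K"
  proof
    assume "loc c \<in> K"
    then have "inverse (loc c) \<in> V" using K_inverse K_V by blast
    then show False using \<open>inverse (loc c) \<notin> V\<close> by blast
  qed
  moreover have "loc c \<in> conjugate b -` V" using conjugate_L[OF loc_L, of c] P_V[OF c] by simp
  moreover have "K \<subseteq> conjugate b -` V" using conjugate_K K_V by auto
  moreover have "inverse (loc c) \<notin> conjugate b -` V"
    using conjugate_inverse[of "loc c"] conjugate_L[OF loc_L, of c] \<open>inverse (loc c) \<notin> V\<close> by simp
  moreover have "subring (conjugate b -` V) ambient" unfolding subring_ambient_iff
    using V_closed by (auto simp: conjugate_1 conjugate_uminus conjugate_mult conjugate_add)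
  moreover have "z \<in> conjugate b -` V \<or> inverse z \<in> conjugate b -` V" for z
    using V_or_inverse[of "conjugate b z"] by (simp add: conjugate_inverse)
  ultimately have "valuation_ring K UNIV (conjugate b -` V)" unfolding valuation_ring_def by blast
  moreover have "conjugate b -` P = {z \<in> conjugate b -` V. \<not> (z \<noteq> 0 \<and> inverse z \<in> conjugate b -` V)}"
    by (auto simp: P_iff conjugate_inverse conjugate_eq_0_iff)
  ultimately show "place K UNIV (conjugate b -` P)" unfolding place_def by blast
  show "ring_of_place UNIV (conjugate b -` P) = conjugate b -` V"
    unfolding ring_of_place_def by (auto simp: conjugate_inverse conjugate_eq_0_iff)
qed

end

text \<open>
  The factor \<open>\<iota> b ^ (m - k)\<close> stands for \<open>b\<^bsup>-k\<^esup>\<close>; the orthogonality of the roots of unity leaves only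
  the \<open>k\<close>-th term.
\<close>

lemma average_conjugates:
  assumes p: "p \<in> poly_over L" "Polynomial.degree p < m" and k: "k < m"
  shows "(\<Sum>b | b ^ m = 1. \<iota> b ^ (m - k) * conjugate b (poly p y)) = of_nat m * (Polynomial.coeff p k * y ^ k)"
proof -
  let ?W = "{b::'k. b ^ m = 1}"
  have m0: "m > 0" using m(1) by simp
  have conjugate: "conjugate b (poly p y) = (\<Sum>i<m. Polynomial.coeff p i * (\<iota> b * y) ^ i)" if "b \<in> ?W" for b
  proof -
    have "conjugate b (poly p y) = poly p (\<iota> b * y)" using conjugate_poly[OF _ p(1)] that by simp
    also have "\<dots> = (\<Sum>i<m. Polynomial.coeff p i * (\<iota> b * y) ^ i)" unfolding poly_altdef
      by (rule sum.mono_neutral_left) (use p(2) in \<open>auto intro: coeff_eq_0\<close>)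
    finally show ?thesis .
  qed
  have "(\<Sum>b\<in>?W. \<iota> b ^ (m - k) * conjugate b (poly p y))
      = (\<Sum>b\<in>?W. \<Sum>i<m. Polynomial.coeff p i * y ^ i * \<iota> (b ^ (m - k + i)))"
    by (rule sum.cong[OF refl])
      (simp add: conjugate sum_distrib_left \<iota>_power \<iota>_mult power_add power_mult_distrib mult_ac)
  also have "\<dots> = (\<Sum>i<m. Polynomial.coeff p i * y ^ i * \<iota> (\<Sum>b\<in>?W. b ^ (m - k + i)))"
    by (subst sum.swap) (simp add: \<iota>_sum sum_distrib_left)
  also have "\<dots> = (\<Sum>i<m. if i = k then of_nat m * (Polynomial.coeff p k * y ^ k) else 0)"
  proof (rule sum.cong[OF refl])
    fix i assume i: "i \<in> {..<m}"
    show "Polynomial.coeff p i * y ^ i * \<iota> (\<Sum>b\<in>?W. b ^ (m - k + i)) =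
        (if i = k then of_nat m * (Polynomial.coeff p k * y ^ k) else 0)"
    proof (cases "i = k")
      case True
      then have "(\<Sum>b\<in>?W. b ^ (m - k + i)) = of_nat m"
        using k card_roots_of_unity(2)[OF m0 m(2)] by simp
      then show ?thesis using True by (simp add: \<iota>_of_nat)
    next
      case False
      have "\<not> m dvd m - k + i"
      proof
        assume "m dvd m - k + i"
        then obtain q where q: "m - k + i = m * q" by (elim dvdE)
        have "0 < m * q" "m * q < m * 2" unfolding q[symmetric] using k i by auto
        then have "q = 1" by auto
        then show False using q k False by simp
      qed
      then show ?thesis using False sum_roots_of_unity_power[OF m0 m(2)] \<iota>_0 by simp
    qed
  qed
  finally show ?thesis using k by simp
qed

end

context function_field
begin


text \<open>
  If two distinct local parameters were in \<open>P\<close>, then so would be a nonzero constant.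
\<close>

lemma loc_unique:
  assumes P: "place K UNIV P" and c: "loc c \<in> P" "loc c' \<in> P" shows "c = c'"
proof (rule ccontr)
  interpret rational_field_place \<iota> x UNIV P using rational_field_placeI[OF P] .
  have inf: "loc (Some a) \<notin> P" if "loc None \<in> P" for a
  proof
    assume "loc (Some a) \<in> P"
    then have "x - \<iota> a + \<iota> a \<in> V" by (intro V_closed(5) P_V \<iota>_V) simp
    then have "x * inverse x \<in> P" using that P_mult' by simp
    then show False using x_nonzero one_notin_P by simp
  qed
  assume "c \<noteq> c'"
  then obtain a b where ab: "c = Some a" "c' = Some b" "a \<noteq> b"
    using inf c by (cases c; cases c') auto
  have "loc c' - loc c \<in> P" using c P_diff by blast
  then have "\<iota> (a - b) \<in> P" using ab \<iota>_diff by simp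
  then show False using \<iota>_U[of "a - b"] ab by simp
qed

lemma x_in_V: 
  assumes P: "place K UNIV P" and c: "loc (Some a) \<in> P" shows "x \<in> ring_of_place UNIV P"
proof -
  interpret rational_field_place \<iota> x UNIV P using rational_field_placeI[OF P] .
  have "x - \<iota> a + \<iota> a \<in> V" using c by (intro V_closed(5) P_V \<iota>_V) simp
  then show ?thesis by simp
qed

end

context kummer_extension
begin

lemma y_in_V: 
  assumes P: "place K UNIV P" and c: "loc (Some a) \<in> P" shows "y \<in> ring_of_place UNIV P"
proof -
  interpret rational_field_place \<iota> x UNIV P using rational_field_placeI[OF P] .
  have "y ^ m \<in> V" unfolding y_power using x_in_V[OF P c] evl_V by blast
  then show ?thesis using V_if_power_V[of y m] m(1) by simp
qed

text \<open>
  At \<open>P\<close> the function \<open>y\<close> has a residue \<open>e\<close> with \<open>e\<^sup>m = g(a) \<noteq> 0\<close>. At the conjugate of \<open>P\<close> under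
  \<open>b \<noteq> 1\<close> it is \<open>\<iota> b y\<close> that has residue \<open>e\<close>, so the two places differ, although they agree on \<open>K(x)\<close>.
\<close>

lemma unramified_place_not_unique:
  assumes P: "place K UNIV P" and c: "loc (Some a) \<in> P" and a: "poly g a \<noteq> 0"
    and Q: "Q \<subseteq> L" "Q \<subseteq> P"
  shows "\<exists>P'. place K UNIV P' \<and> Q \<subseteq> P' \<and> P' \<noteq> P"
proof -
  interpret rational_field_place \<iota> x UNIV P using rational_field_placeI[OF P] .
  have m0: "m > 0" using m(1) by simp
  have "\<exists>b::'k. b ^ m = 1 \<and> b \<noteq> 1"
  proof (rule ccontr)
    assume "\<not> ?thesis"
    then have "{b::'k. b ^ m = 1} \<subseteq> {1}" by blast
    then have "card {b::'k. b ^ m = 1} \<le> card {1::'k}" by (rule card_mono[rotated]) simp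
    then show False using card_roots_of_unity(2)[OF m0 m(2)] m(1) by simp
  qed
  then obtain b :: 'k where b: "b ^ m = 1" "b \<noteq> 1" by blast
  have yV: "y \<in> V" using y_in_V[OF P c] .
  let ?p = "[:0,1:] ^ m - [:poly g a:] :: 'k poly"
  have "?p \<noteq> 0"
  proof
    assume "?p = 0"
    then have "Polynomial.degree ([:0,1:] ^ m :: 'k poly) = Polynomial.degree [:poly g a:]" by simp
    then show False using m(1) by (simp add: degree_power_eq)
  qed
  have "[:-a,1:] dvd g - [:poly g a:]" by (simp flip: poly_eq_0_iff_dvd)
  then obtain w where w: "g - [:poly g a:] = [:-a,1:] * w" by (elim dvdE)
  have "evl y ?p = y ^ m - \<iota> (poly g a)" by (simp add: evl_diff evl_power \<iota>_0 \<iota>_1)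
  also have "\<dots> = evl x (g - [:poly g a:])" by (simp add: evl_diff y_power)
  also have "\<dots> = (x - \<iota> a) * evl x w" unfolding w evl_mult by (simp add: \<iota>_1 \<iota>_uminus)
  also have "\<dots> \<in> P" using c evl_V[OF x_in_V[OF P c]] by (intro P_mult) auto
  finally have "evl y ?p \<notin> U" by blast
  then obtain e where e: "y - \<iota> e \<in> P" using evl_unit_if_no_root[OF yV \<open>?p \<noteq> 0\<close>] by blast
  have "conjugate b -` P \<noteq> P"
  proof
    assume "conjugate b -` P = P"
    then have "conjugate b (y - \<iota> e) \<in> P" using e by blast
    moreover have "conjugate b (y - \<iota> e) = \<iota> b * y - \<iota> e"
      using conjugate_add[OF b(1), of y "- \<iota> e"] conjugate_y[OF b(1)] conjugate_uminus[OF b(1)] conjugate_K[OF b(1)]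
      unfolding K_def by simp
    ultimately have "\<iota> b * y - \<iota> e \<in> P" by simp
    then have "(\<iota> b * y - \<iota> e) - (y - \<iota> e) \<in> P" by (rule P_diff[OF _ e])
    then have "\<iota> (b - 1) * y \<in> P" by (simp add: \<iota>_diff \<iota>_1 algebra_simps)
    moreover have "\<iota> (b - 1) \<in> U" using b \<iota>_U[of "b - 1"] by simp
    ultimately have "y \<in> P" using P_prime[of "\<iota> (b - 1)" y] yV by blast
    then have "y ^ m \<in> P" using P_mult[of y "y ^ (m - 1)"] V_closed(7)[OF yV] m0
      by (simp flip: power_Suc)
    moreover obtain u where "u \<in> U" "evl x g = loc (Some a) powi pord (Some a) g * u"
      using evl_x_local[OF c g_nonzero] by blast
    then have "evl x g \<in> U" using order_0I[OF a] by simp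
    ultimately show False unfolding y_power by blast
  qed
  moreover have "Q \<subseteq> conjugate b -` P" using Q conjugate_L[OF b(1)] by auto
  ultimately show ?thesis using conjugate_place(1)[OF b(1) P] by blast
qed

text \<open>
  All conjugates of the function are regular at any place \<open>P\<close> over \<open>a\<close>, because conjugation moves
  \<open>P\<close> to another place over \<open>a\<close>. Hence the average \<open>h y\<^sup>k\<close> is regular at \<open>P\<close>, and
  \<open>m ord(h) + k ord(g) \<ge> 0\<close>. Since \<open>ord(g) \<le> 1\<close> and \<open>k < m\<close>, this forces \<open>ord(h) \<ge> 0\<close>.
\<close>

lemma coefficient_regular:
  assumes p: "p \<in> poly_over L" "Polynomial.degree p < m"
    and reg: "\<And>P. place K UNIV P \<Longrightarrow> loc (Some a) \<in> P \<Longrightarrow> poly p y \<in> ring_of_place UNIV P"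
    and k: "Polynomial.coeff p k = evl x n / evl x d'" "n \<noteq> 0" "d' \<noteq> 0"
  shows "Polynomial.order a d' \<le> Polynomial.order a n"
proof -
  obtain P where P: "place K UNIV P" "loc (Some a) \<in> P" using ex_place_over by blast
  interpret rational_field_place \<iota> x UNIV P using rational_field_placeI[OF P(1)] .
  obtain t where "discrete_place K UNIV P t" using place_discrete[OF P(1)] by blast
  then interpret D: discrete_place K UNIV P t .
  let ?v = "val UNIV P"
  let ?h = "Polynomial.coeff p k"
  have h0: "?h \<noteq> 0" using k by (simp add: evl_x_eq_0_iff)
  then have km: "k < m" using le_degree[of p k] p(2) by simp
  have "conjugate b (poly p y) \<in> V" if b: "b ^ m = 1" for b
  proof -
    have "loc (Some a) \<in> conjugate b -` P" using conjugate_L[OF b loc_L, of "Some a"] P(2) by simp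
    then show ?thesis using reg[OF conjugate_place(1)[OF b P(1)]] conjugate_place(2)[OF b P(1)] by blast
  qed
  then have "(\<Sum>b | b ^ m = 1. \<iota> b ^ (m - k) * conjugate b (poly p y)) \<in> V"
    by (intro subring_ambient_sum[OF subring_V] V_closed(4,7) \<iota>_V) auto
  then have *: "of_nat m * (?h * y ^ k) \<in> V" using average_conjugates[OF p km] by simp
  have "of_nat m \<in> U" using \<iota>_U[OF m(2)] \<iota>_of_nat by simp
  then have "inverse (of_nat m) \<in> V" "of_nat m \<noteq> (0::'f)" using U_iff by blast+
  then have "?h * y ^ k \<in> V" using V_closed(4)[OF _ *, of "inverse (of_nat m)"] by (simp add: field_simps)
  then have "?v (?h * y ^ k) \<ge> 0" using D.val_V[of "?h * y ^ k"] h0 y_nonzero by simp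
  then have "?v ?h + int k * ?v y \<ge> 0"
    using D.val_mult[of ?h "y ^ k"] D.val_power[of y k] h0 y_nonzero by simp
  then have "int m * (?v ?h + int k * ?v y) \<ge> 0" by simp
  also have "int m * (?v ?h + int k * ?v y) = int m * ?v ?h + int k * (int m * ?v y)"
    by (simp add: algebra_simps)
  also have "\<dots> = (int m * (pord (Some a) n - pord (Some a) d') + int k * pord (Some a) g) * ?v (loc (Some a))"
    unfolding k(1) val_L[OF P k(2,3)] val_y[OF P] by (simp add: algebra_simps)
  finally have ge: "(int m * (pord (Some a) n - pord (Some a) d') + int k * pord (Some a) g)
      * ?v (loc (Some a)) \<ge> 0" .
  have "?v (loc (Some a)) > 0" using D.val_P[OF UNIV_I loc_nonzero[of "Some a"]] P(2) by blast
  then have "int m * (pord (Some a) n - pord (Some a) d') + int k * pord (Some a) g \<ge> 0"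
    using ge unfolding zero_le_mult_iff by linarith
  moreover have "int k * pord (Some a) g \<le> int k * 1" using order_g[of a] by (intro mult_left_mono) auto
  ultimately have "int m * (pord (Some a) n - pord (Some a) d') > int m * (-1)" using km by linarith
  then have "pord (Some a) n - pord (Some a) d' > -1" using m(1) by (simp only: mult_less_cancel_left)
  then show ?thesis by simp
qed

section \<open>Functions with poles at infinity and at one ramified place\<close>

text \<open>
  Here \<open>k\<close> is the term that determines the value at infinity and \<open>D\<close> is the degree of its
  coefficient. The coefficient has no finite pole except \<open>a\<close>, so its order at \<open>a\<close> is at most \<open>D\<close>.
\<close>

lemma poles_at_infinity_and_root:
  assumes P_inf: "place K UNIV P_inf" "loc None \<in> P_inf"
    and P: "place K UNIV P" "loc (Some a) \<in> P" and a: "poly g a = 0"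
    and z: "z \<noteq> 0"
      "\<And>P'. place K UNIV P' \<Longrightarrow> P' \<noteq> P_inf \<Longrightarrow> P' \<noteq> P \<Longrightarrow> z \<in> ring_of_place UNIV P'"
  shows "\<exists>k D. k < m \<and> val UNIV P_inf z = - (int m * D + int (Polynomial.degree g) * int k)
    \<and> val UNIV P z \<le> int m * D + int k"
proof -
  obtain p where p: "p \<in> poly_over L" "Polynomial.degree p < m" "poly p y = z"
    using reduced_representation by blast
  have p0: "p \<noteq> 0" using p(3) z by auto
  let ?I = "{k. Polynomial.coeff p k \<noteq> 0}"
  have "?I \<subseteq> {..Polynomial.degree p}" using le_degree by auto
  then have fin: "finite ?I" and Im: "k \<in> ?I \<Longrightarrow> k < m" for k using p(2) finite_subset by fastforce+
  have ne: "?I \<noteq> {}" using p0 by (auto intro!: exI[of _ "Polynomial.degree p"])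
  note inf = ramified_place[OF P_inf coprime_infinity]
  note root = ramified_place[OF P coprime_root[OF a]]
  let ?v = "\<lambda>k. val UNIV P_inf (Polynomial.coeff p k) + int k * pord None g"
  let ?w = "\<lambda>k. val UNIV P (Polynomial.coeff p k) + int k * pord (Some a) g"
  have vz: "val UNIV P_inf z = Min (?v ` ?I)" using inf(3)[OF p(1) p0 p(2)] p(3) by simp
  have "Min (?v ` ?I) \<in> ?v ` ?I" using fin ne by simp
  then obtain k where k: "k \<in> ?I" "val UNIV P_inf z = ?v k" using vz by auto
  have wz: "val UNIV P z \<le> ?w k" using root(3)[OF p(1) p0 p(2)] p(3) fin k(1) by auto
  interpret rational_field_place \<iota> x UNIV P using rational_field_placeI[OF P(1)] .
  obtain n d' where nd: "n \<noteq> 0" "d' \<noteq> 0" "Polynomial.coeff p k = evl x n / evl x d'"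
    using L_nonzero_cases[of "Polynomial.coeff p k"] k(1) p(1) unfolding poly_over_def by blast
  have "Polynomial.order b d' \<le> Polynomial.order b n" if b: "b \<noteq> a" for b
  proof (rule coefficient_regular[OF p(1,2) _ nd(3,1,2)])
    fix P' assume P': "place K UNIV P'" "loc (Some b) \<in> P'"
    have "P' \<noteq> P_inf" using loc_unique[OF P'] P_inf(2) by blast
    moreover have "P' \<noteq> P" using loc_unique[OF P'] P(2) b by blast
    ultimately show "poly p y \<in> ring_of_place UNIV P'" using z(2)[OF P'(1)] p(3) by simp
  qed
  then have le: "int (Polynomial.order a n) - int (Polynomial.order a d') \<le> int (Polynomial.degree n) - int (Polynomial.degree d')"
    by (rule order_diff_le_degree_diff[OF nd(1,2)])
  define D where "D = int (Polynomial.degree n) - int (Polynomial.degree d')"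
  have "val UNIV P_inf z = - (int m * D + int (Polynomial.degree g) * int k)"
    unfolding k(2) nd(3) val_L[OF P_inf nd(1,2)] inf(1) D_def by (simp add: algebra_simps)
  moreover have "val UNIV P (Polynomial.coeff p k) \<le> int m * D"
    using mult_left_mono[OF le, of "int m"]
    unfolding nd(3) val_L[OF P nd(1,2)] root(1) D_def by (simp add: mult.commute)
  then have "val UNIV P z \<le> int m * D + int k" using wz order_root_g[OF a] by simp
  ultimately show ?thesis using Im k(1) by blast
qed

lemma pole_divisor_eqI:
  assumes "\<And>P'. place K UNIV P' \<Longrightarrow> P' \<noteq> R1 \<Longrightarrow> P' \<noteq> R2 \<Longrightarrow> z \<in> ring_of_place UNIV P'"
    and "z \<noteq> 0" "place K UNIV R1" "place K UNIV R2" "R1 \<noteq> R2"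
    and "val UNIV R1 z = - int n1" "val UNIV R2 z = - int n2"
  shows "pole_divisor K z = (\<lambda>P'. place_divisor n1 R1 P' + place_divisor n2 R2 P')"
proof
  fix P'
  have "\<not> val UNIV P' z < 0" if P': "place K UNIV P'" "P' \<noteq> R1" "P' \<noteq> R2"
  proof -
    obtain t where "discrete_place K UNIV P' t" using place_discrete[OF P'(1)] by blast
    then interpret D: discrete_place K UNIV P' t .
    show ?thesis using D.val_V[of z] assms(1)[OF P'] assms(2) by simp
  qed
  moreover have "pole_divisor K z R1 = int n1" "pole_divisor K z R2 = int n2"
    using assms(3,4,6,7) unfolding pole_divisor_def by simp_all
  ultimately show "pole_divisor K z P' = place_divisor n1 R1 P' + place_divisor n2 R2 P'"
    using assms(5) unfolding place_divisor_def
    by (cases "P' = R1"; cases "P' = R2") (simp_all add: pole_divisor_def)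
qed

lemma pole_divisor_eqD:
  assumes eq: "pole_divisor K z = (\<lambda>P'. place_divisor n1 R1 P' + place_divisor n2 R2 P')"
    and z: "z \<noteq> 0" and P': "place K UNIV P'" "P' \<noteq> R1" "P' \<noteq> R2"
  shows "z \<in> ring_of_place UNIV P'"
proof -
  obtain t where "discrete_place K UNIV P' t" using place_discrete[OF P'(1)] by blast
  then interpret D: discrete_place K UNIV P' t .
  have "pole_divisor K z P' = 0" using fun_cong[OF eq, of P'] P' unfolding place_divisor_def by simp
  then have "val UNIV P' z \<ge> 0" using P' unfolding pole_divisor_def by (auto split: if_splits)
  then show ?thesis using D.val_V[of z] z by simp
qed

context
  fixes P_inf P :: "'f set" and a :: 'k
  assumes P_inf: "place K UNIV P_inf" "loc None \<in> P_inf"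
    and P: "place K UNIV P" "loc (Some a) \<in> P" and a: "poly g a = 0"
begin

abbreviation r where "r \<equiv> Polynomial.degree g"

lemma P_inf_neq_P: "P_inf \<noteq> P"
  using loc_unique[OF P_inf] P(2) by blast

lemma finite_if_not_P_inf:
  assumes P': "place K UNIV P'" "P' \<noteq> P_inf" obtains b where "loc (Some b) \<in> P'"
proof -
  obtain c where c: "loc c \<in> P'" using ex_loc_in_place[OF P'(1)] by blast
  then have "c \<noteq> None" using ramified_place_unique[OF P'(1) _ P_inf coprime_infinity] P'(2) by auto
  then show ?thesis using that c by auto
qed

text \<open>
  The pole divisor of \<open>x\<^sup>A y\<^sup>k\<close> is concentrated at infinity.
\<close>

lemma semigroup_generated: "m * A + r * k \<in> weierstrass_semigroup K P_inf"
proof -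
  obtain t where "discrete_place K UNIV P_inf t" using place_discrete[OF P_inf(1)] by blast
  then interpret D: discrete_place K UNIV P_inf t .
  let ?z = "x ^ A * y ^ k"
  define N where "N = m * A + r * k"
  have "val UNIV P_inf x = - int m"
    using D.val_inverse[of x] x_nonzero val_loc_ramified[OF P_inf coprime_infinity] by simp
  then have val: "val UNIV P_inf ?z = - int N"
    using D.val_mult[of "x ^ A" "y ^ k"] D.val_power x_nonzero y_nonzero
      val_y_ramified[OF P_inf coprime_infinity] unfolding N_def by (simp add: algebra_simps)
  have reg: "?z \<in> ring_of_place UNIV P'" if P': "place K UNIV P'" "P' \<noteq> P_inf" for P'
  proof -
    obtain b where b: "loc (Some b) \<in> P'" using finite_if_not_P_inf[OF P'] .
    interpret E: rational_field_place \<iota> x UNIV P' using rational_field_placeI[OF P'(1)] .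
    show ?thesis by (intro E.V_closed(4,7) x_in_V[OF P'(1) b] y_in_V[OF P'(1) b])
  qed
  have "pole_divisor K ?z P' = place_divisor N P_inf P'" for P'
  proof (cases "P' = P_inf")
    case True
    then show ?thesis using val P_inf(1) unfolding pole_divisor_def place_divisor_def by auto
  next
    case False
    have "val UNIV P' ?z \<ge> 0" if P': "place K UNIV P'"
    proof -
      obtain t where "discrete_place K UNIV P' t" using place_discrete[OF P'] by blast
      then interpret D': discrete_place K UNIV P' t .
      show ?thesis using D'.val_V[of ?z] reg[OF P' False] x_nonzero y_nonzero by simp
    qed
    then show ?thesis using False unfolding pole_divisor_def place_divisor_def by auto
  qed
  moreover have "?z \<noteq> 0" using x_nonzero y_nonzero by simp
  ultimately show ?thesis unfolding weierstrass_semigroup_def N_def[symmetric] by blast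
qed

text \<open>
  Witnessed by \<open>y\<^bsup>m-i\<^esup> / (x - \<iota> a)\<^sup>j\<close>, which is regular elsewhere because \<open>P\<close> is the only zero of
  \<open>x - \<iota> a\<close> and \<open>P_inf\<close> is the only pole of \<open>x\<close>.
\<close>

lemma semigroup2_realize:
  fixes i j :: nat
  assumes ij: "i \<ge> 1" "j \<ge> 1" "m * j + r * i < m * r"
  shows "(m * r - m * j - r * i, i + m * (j - 1)) \<in> weierstrass_semigroup2 K P_inf P"
proof -
  obtain t where "discrete_place K UNIV P_inf t" using place_discrete[OF P_inf(1)] by blast
  then interpret D: discrete_place K UNIV P_inf t .
  obtain t' where "discrete_place K UNIV P t'" using place_discrete[OF P(1)] by blast
  then interpret D': discrete_place K UNIV P t' .
  note inf = ramified_place[OF P_inf coprime_infinity]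
  note root = ramified_place[OF P coprime_root[OF a]]
  have "r * i < r * m" unfolding mult.commute[of r m] using ij(3) by linarith
  then have im: "i < m" by simp
  let ?s = "loc (Some a)"
  let ?z = "y ^ (m - i) / ?s ^ j"
  have s0: "?s \<noteq> 0" by (rule loc_nonzero)
  have z0: "?z \<noteq> 0" using s0 y_nonzero by simp
  have vs: "val UNIV P_inf ?s = - int m"
    using val_L[OF P_inf, of "[:-a,1:]" 1] inf(1) by (simp add: \<iota>_uminus \<iota>_1)
  have "val UNIV P_inf ?z = int (m - i) * - int r + int j * int m"
    using D.val_divide[of "y ^ (m - i)" "?s ^ j"] D.val_power vs inf(2) s0 y_nonzero by simp
  also have "\<dots> = - int (m * r - m * j - r * i)"
    using im ij(3) by (simp add: of_nat_diff algebra_simps)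
  finally have v1: "val UNIV P_inf ?z = - int (m * r - m * j - r * i)" .
  have "val UNIV P ?z = int (m - i) - int j * int m"
    using D'.val_divide[of "y ^ (m - i)" "?s ^ j"] D'.val_power root(1,2) order_root_g[OF a] s0 y_nonzero
    by simp
  also have "\<dots> = - int (i + m * (j - 1))"
    using im ij(2) by (cases j) (simp_all add: of_nat_diff algebra_simps)
  finally have v2: "val UNIV P ?z = - int (i + m * (j - 1))" .
  have "?z \<in> ring_of_place UNIV P'" if P': "place K UNIV P'" "P' \<noteq> P_inf" "P' \<noteq> P" for P'
  proof -
    obtain b where b: "loc (Some b) \<in> P'" using finite_if_not_P_inf[OF P'(1,2)] .
    interpret E: rational_field_place \<iota> x UNIV P' using rational_field_placeI[OF P'(1)] .
    have "?s \<notin> P'" using ramified_place_unique[OF P'(1) _ P coprime_root[OF a]] P'(3) by blast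
    then have "inverse ?s \<in> E.V" using x_in_V[OF P'(1) b] E.\<iota>_V[of a] E.V_closed(6) E.U_iff by auto
    then have "y ^ (m - i) * inverse ?s ^ j \<in> E.V"
      by (intro E.V_closed(4,7) y_in_V[OF P'(1) b])
    then show ?thesis by (simp add: divide_inverse power_inverse)
  qed
  then have "pole_divisor K ?z = (\<lambda>P'. place_divisor (m * r - m * j - r * i) P_inf P'
      + place_divisor (i + m * (j - 1)) P P')"
    by (rule pole_divisor_eqI[OF _ z0 P_inf(1) P(1) P_inf_neq_P v1 v2])
  then show ?thesis unfolding weierstrass_semigroup2_def using z0 by blast
qed

text \<open>
  The pole order at infinity is \<open>m D + r k\<close>, which modulo \<open>m\<close> determines \<open>k = m - i\<close>
  and then \<open>D = - j\<close>.
\<close>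

lemma semigroup2_lower_bound:
  fixes i j c :: nat
  assumes ij: "i \<ge> 1" "j \<ge> 1" "m * j + r * i < m * r"
    and c: "(m * r - m * j - r * i, c) \<in> weierstrass_semigroup2 K P_inf P"
  shows "i + m * (j - 1) \<le> c"
proof -
  let ?b = "m * r - m * j - r * i"
  obtain z where z: "z \<noteq> 0" "pole_divisor K z = (\<lambda>P'. place_divisor ?b P_inf P' + place_divisor c P P')"
    using c unfolding weierstrass_semigroup2_def by blast
  define B where "B = int ?b"
  have "?b > 0" using ij(3) by linarith
  then have "B > 0" unfolding B_def by (simp only: of_nat_0_less_iff)
  moreover have "pole_divisor K z P_inf = B"
    using fun_cong[OF z(2), of P_inf] P_inf_neq_P unfolding place_divisor_def B_def by simp
  ultimately have v1: "val UNIV P_inf z = - B"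
    unfolding pole_divisor_def by (auto split: if_splits)
  have v2: "pole_divisor K z P = int c"
    using fun_cong[OF z(2), of P] P_inf_neq_P unfolding place_divisor_def by auto
  obtain k D where kD: "k < m" "val UNIV P_inf z = - (int m * D + int r * int k)"
    "val UNIV P z \<le> int m * D + int k"
    using poles_at_infinity_and_root[OF P_inf P a z(1) pole_divisor_eqD[OF z(2,1)]] by blast
  have "r * i < r * m" unfolding mult.commute[of r m] using ij(3) by linarith
  then have im: "i < m" by simp
  have eq: "int m * D + int r * int k = int m * int r - int m * int j - int r * int i"
    using v1 kD(2) ij(3) unfolding B_def by (simp add: of_nat_diff)
  then have "int r * (int k + int i) = int m * (int r - int j - D)" by (simp add: algebra_simps)
  then have "int m dvd int k + int i"
    using coprime_m_degree by (metis coprime_dvd_mult_right_iff coprime_int_iff dvd_triv_left)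
  then obtain q where q: "int k + int i = int m * q" by (elim dvdE)
  have "0 < int m * q" "int m * q < int m * 2" unfolding q[symmetric] using ij(1) kD(1) im by auto
  then have "q > 0" "q < 2" using m(1) by (auto simp: zero_less_mult_iff)
  then have "q = 1" by simp
  then have k: "int k = int m - int i" using q by simp
  have "int m * D = int m * (- int j)" using eq unfolding k by (simp add: algebra_simps)
  then have "D = - int j" using m(1) by (simp only: mult_cancel_left) simp
  then have "val UNIV P z \<le> int m * (- int j) + (int m - int i)" using kD(3) unfolding k by simp
  also have "\<dots> = - int (i + m * (j - 1))"
    using ij(2) by (cases j) (simp_all add: algebra_simps)
  finally have "val UNIV P z \<le> - int (i + m * (j - 1))" .
  then have "- val UNIV P z \<ge> int (i + m * (j - 1))" "val UNIV P z < 0" using ij(1) by linarith+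
  then have "int (i + m * (j - 1)) \<le> int c" using v2 P(1) unfolding pole_divisor_def by simp
  then show ?thesis by (simp only: of_nat_le_iff)
qed

lemma min_partner_eq:
  fixes i j :: nat
  assumes ij: "i \<ge> 1" "j \<ge> 1" "m * j + r * i < m * r"
  shows "min_partner K P_inf P (m * r - m * j - r * i) = i + m * (j - 1)"
  unfolding min_partner_def
  by (rule Least_equality) (use semigroup2_realize[OF ij] semigroup2_lower_bound[OF ij] in auto)

text \<open>
  Numbers of the given form are gaps: a function with no pole at \<open>P\<close> would contradict the positive
  lower bound for the pole order there. Conversely, let \<open>b\<close> be a gap and choose \<open>i < m\<close> with \<open>m\<close>
  dividing \<open>b + r i\<close>; if \<open>i = 0\<close> or if \<open>b + r i \<ge> m r\<close>, then \<open>b\<close> would be of the form \<open>m A + r k\<close>.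
\<close>

lemma gaps_eq: "gaps K P_inf = {m * r - m * j - r * i | i j. i \<ge> 1 \<and> j \<ge> 1 \<and> m * j + r * i < m * r}"
proof (intro equalityI subsetI)
  fix b assume "b \<in> {m * r - m * j - r * i | i j. i \<ge> 1 \<and> j \<ge> 1 \<and> m * j + r * i < m * r}"
  then obtain i j where ij: "i \<ge> 1" "j \<ge> 1" "m * j + r * i < m * r" "b = m * r - m * j - r * i" by blast
  show "b \<in> gaps K P_inf"
  proof (rule ccontr)
    assume "b \<notin> gaps K P_inf"
    moreover have "place_divisor 0 P = (\<lambda>P'. 0)" by (auto simp: place_divisor_def fun_eq_iff)
    ultimately have "(b, 0) \<in> weierstrass_semigroup2 K P_inf P"
      unfolding gaps_def weierstrass_semigroup_def weierstrass_semigroup2_def by auto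
    then show False using semigroup2_lower_bound[OF ij(1-3)] ij by fastforce
  qed
next
  fix b assume b: "b \<in> gaps K P_inf"
  then have not: "b \<noteq> m * A + r * k" for A k using semigroup_generated unfolding gaps_def by blast
  obtain s w where "s * int r + w * int m = gcd (int r) (int m)" using bezout_int by blast
  then have "1 - int r * s = int m * w"
    using coprime_m_degree by (simp add: coprime_iff_gcd_eq_1 gcd.commute algebra_simps)
  then have s: "int m dvd 1 - int r * s" by simp
  \<comment> \<open>\<open>s\<close> is an inverse of \<open>r\<close> modulo \<open>m\<close>.\<close>
  define i where "i = nat ((- s * int b) mod int m)"
  have i: "int i = (- s * int b) mod int m" "i < m" unfolding i_def using m(1) by (auto simp: nat_less_iff)
  have "int b + int r * int i = int b * (1 - int r * s) - int r * ((- s * int b) - (- s * int b) mod int m)"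
    unfolding i(1) by (simp add: algebra_simps)
  moreover have "int m dvd (- s * int b) - (- s * int b) mod int m" by (simp add: dvd_minus_mod)
  ultimately have "int m dvd int b + int r * int i" using s by (metis dvd_diff dvd_mult)
  then obtain q where q: "int b + int r * int i = int m * q" by (elim dvdE)
  have "q \<ge> 0"
  proof (rule ccontr)
    assume "\<not> q \<ge> 0"
    then have "int m * q < 0" using m(1) by (simp add: mult_pos_neg)
    then show False using q by (metis of_nat_0_le_iff of_nat_add of_nat_mult not_less)
  qed
  define n where "n = nat q"
  have n: "b + r * i = m * n" using q \<open>q \<ge> 0\<close> unfolding n_def
    by (metis int_nat_eq of_nat_add of_nat_eq_iff of_nat_mult)
  have "i \<ge> 1"
  proof (rule ccontr)
    assume "\<not> i \<ge> 1"
    then have "i = 0" by simp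
    then show False using not[of n 0] n by simp
  qed
  moreover have "n < r"
  proof (rule ccontr)
    assume "\<not> n < r"
    then obtain n' where "n = r + n'" using le_Suc_ex not_less by blast
    then have "b = m * n' + r * (m - i)"
      using n i(2) by (simp add: algebra_simps diff_mult_distrib2)
    then show False using not by blast
  qed
  moreover have "b > 0" using not[of 0 0] by simp
  ultimately have "1 \<le> i \<and> 1 \<le> r - n \<and> m * (r - n) + r * i < m * r \<and> b = m * r - m * (r - n) - r * i"
  proof -
    assume h: "i \<ge> 1" "n < r" "b > 0"
    have "m * (r - n) + m * n = m * r" using h(2) by (simp flip: distrib_left)
    then show ?thesis using n h by auto
  qed
  then show "b \<in> {m * r - m * j - r * i | i j. i \<ge> 1 \<and> j \<ge> 1 \<and> m * j + r * i < m * r}" by blast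
qed

lemma Gamma_set_eq:
  "Gamma_set K P_inf P =
    {(m * r - m * j - r * i, i + m * (j - 1)) | i j. i \<ge> 1 \<and> j \<ge> 1 \<and> m * j + r * i < m * r}"
proof -
  have "Gamma_set K P_inf P = (\<lambda>b. (b, min_partner K P_inf P b)) ` gaps K P_inf"
    unfolding Gamma_set_def by blast
  also have "\<dots> = {(b, min_partner K P_inf P b) | b i j.
      b = m * r - m * j - r * i \<and> i \<ge> 1 \<and> j \<ge> 1 \<and> m * j + r * i < m * r}"
    unfolding gaps_eq by blast
  also have "\<dots> = {(m * r - m * j - r * i, i + m * (j - 1)) | i j. i \<ge> 1 \<and> j \<ge> 1 \<and> m * j + r * i < m * r}"
  proof -
    have "(b, min_partner K P_inf P b) = (b, i + m * (j - 1))"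
      if "b = m * r - m * j - r * i \<and> i \<ge> 1 \<and> j \<ge> 1 \<and> m * j + r * i < m * r" for b i j
      using that min_partner_eq[of i j] by simp
    then show ?thesis by (intro Collect_cong) metis
  qed
  finally show ?thesis .
qed

end

end

section \<open>Reduction to a squarefree right-hand side\<close>

lemma ambient_ring_hom_iff:
  "\<iota> \<in> ring_hom (ring_of_type_algebra :: 'a::field ring) (ambient :: 'f::field ring) \<longleftrightarrow>
     (\<forall>a b. \<iota> (a * b) = \<iota> a * \<iota> b) \<and> (\<forall>a b. \<iota> (a + b) = \<iota> a + \<iota> b) \<and> \<iota> 1 = 1"
  unfolding ring_hom_def by (auto simp: Pi_def)

text \<open>
  The definition of transcendence refers to coefficient lists, leading coefficient first.
\<close>

lemma transcendental_poly:
  fixes x :: "'f::field"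
  assumes tr: "ring.transcendental ambient K x" and p: "p \<in> poly_over K" "poly p x = 0"
  shows "p = 0"
proof -
  interpret field "ambient :: 'f ring" by (rule field_from_type_algebra)
  let ?ks = "rev (coeffs p)"
  show ?thesis
  proof (rule ccontr)
    assume "p \<noteq> 0"
    then have "?ks \<noteq> []" "hd ?ks \<noteq> 0" by (simp_all add: hd_rev last_coeffs_eq_coeff_degree)
    moreover have "set ?ks \<subseteq> K" using p(1) unfolding poly_over_def coeffs_def by auto
    ultimately have "?ks \<in> carrier (K [X]\<^bsub>ambient\<^esub>)" unfolding univ_poly_def polynomial_def by simp
    moreover have "eval ?ks x = \<zero>\<^bsub>ambient\<^esub>" using p(2) by (simp add: eval_ambient_eq_poly)
    ultimately have "?ks = []" using eval_transcendental[of K x ?ks] tr unfolding over_def by simp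
    then show False using \<open>?ks \<noteq> []\<close> by simp
  qed
qed

text \<open>
  With \<open>u l + v m = 1\<close>, the element \<open>y\<^sup>u G\<^sup>v\<close> behaves as \<open>G\<^bsup>1/m\<^esup>\<close> and as \<open>y\<^bsup>1/l\<^esup>\<close>.
\<close>

lemma root_of_coprime_power:
  fixes y G :: "'f::field"
  assumes "y ^ m = G ^ l" "coprime m l" "y \<noteq> 0" "G \<noteq> 0"
  obtains u v where "(y powi u * G powi v) ^ m = G" "(y powi u * G powi v) ^ l = y"
proof -
  obtain u v where "u * int l + v * int m = gcd (int l) (int m)" using bezout_int by blast
  then have uv: "u * int l + v * int m = 1" using assms(2) by (simp add: gcd.commute coprime_iff_gcd_eq_1)
  have pw: "(z powi k) ^ n = z powi (k * int n)" for z :: 'f and k n by (simp add: power_int_power')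
  have ym: "y powi (k * int m) = G powi (k * int l)" for k
    using assms(1) by (metis mult.commute power_int_mult power_int_of_nat)
  have "(y powi u * G powi v) ^ m = G powi (u * int l) * G powi (v * int m)"
    unfolding power_mult_distrib pw ym ..
  also have "\<dots> = G" using assms(4) uv by (simp flip: power_int_add)
  finally have 1: "(y powi u * G powi v) ^ m = G" .
  have "(y powi u * G powi v) ^ l = y powi (u * int l) * y powi (v * int m)"
    unfolding power_mult_distrib pw ym ..
  also have "\<dots> = y" using assms(3) uv by (simp flip: power_int_add)
  finally show ?thesis using that 1 by blast
qed

text \<open>
  The ring of polynomials in \<open>z\<close> over \<open>K(x)\<close> is already a field, because \<open>z\<close> is algebraic.
\<close>

lemma (in function_field) generated_by_root:
  assumes F: "generate_field ambient (K \<union> {x, y}) = UNIV" and y: "y = z ^ l"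
  shows "\<exists>p\<in>poly_over L. poly p z = w"
proof -
  interpret field "ambient :: 'b ring" by (rule field_from_type_algebra)
  let ?S = "(\<lambda>p. poly p z) ` poly_over L"
  have "finite_dimension L UNIV" using finite_dimensionI[OF dimension_L] .
  then have "(algebraic over L) z"
    using finite_dimension_imp_algebraic[OF subfield_L subfieldE(1)[OF UNIV_subfield]] by simp
  then have S: "subfield ?S ambient"
    using simple_extension_is_subfield[OF subfield_L, of z] simple_extension_eq_poly_image[OF subring_L]
    by simp
  have LS: "L \<subseteq> ?S"
  proof
    fix h assume "h \<in> L"
    then show "h \<in> ?S" using poly_over_const[OF subring_L] by (intro image_eqI[of _ _ "[:h:]"]) auto
  qed
  have "z \<in> ?S" using poly_over_0[OF subring_L] subring_ambient_0[OF subring_L] evl_L[of 1]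
    by (intro image_eqI[of _ _ "[:0,1:]"]) auto
  then have "y \<in> ?S" unfolding y using subring_ambient_power[OF subfieldE(1)[OF S]] by blast
  then have "generate_field ambient (K \<union> {x, y}) \<subseteq> ?S"
    using LS K_L x_L by (intro generate_field_min_subfield1 S) auto
  then have "w \<in> ?S" unfolding F by (rule subsetD) simp
  then show ?thesis by (elim imageE) blast
qed

lemma order_prod_linear_distinct:
  fixes \<alpha> :: "'i \<Rightarrow> 'a::field"
  assumes "finite I" "inj_on \<alpha> I"
  shows "Polynomial.order a (\<Prod>i\<in>I. [:- \<alpha> i, 1:]) \<le> 1"
  using assms
proof (induction I)
  case empty
  then show ?case by simp
next
  case (insert i I)
  have nz: "(\<Prod>i\<in>I. [:- \<alpha> i, 1:]) \<noteq> 0" using insert.hyps by simp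
  have split: "Polynomial.order a (\<Prod>i\<in>insert i I. [:- \<alpha> i, 1:])
      = Polynomial.order a [:- \<alpha> i, 1:] + Polynomial.order a (\<Prod>i\<in>I. [:- \<alpha> i, 1:])"
    unfolding prod.insert[OF insert.hyps] using nz by (intro order_mult) (simp del: mult_pCons_left)
  show ?case
  proof (cases "a = \<alpha> i")
    case True
    have "poly (\<Prod>i\<in>I. [:- \<alpha> i, 1:]) a \<noteq> 0"
      using insert True by (auto simp: poly_prod inj_on_def)
    then have "Polynomial.order a (\<Prod>i\<in>I. [:- \<alpha> i, 1:]) = 0" by (rule order_0I)
    moreover have "Polynomial.order a [:- \<alpha> i, 1:] = 1"
      using order_power_n_n[of a 1] True by simp
    ultimately show ?thesis unfolding split by simp
  next
    case False
    then have "Polynomial.order a [:- \<alpha> i, 1:] = 0" by (intro order_0I) simp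
    then show ?thesis unfolding split using insert by auto
  qed
qed

text \<open>
  The upper bound for \<open>i\<close> says that \<open>j = 1\<close> is possible; it follows from the bounds for \<open>j\<close>.
\<close>

lemma index_range_iff:
  fixes m r :: nat and i j :: int
  assumes "m > 0" "r > 0"
  shows "(1 \<le> i \<and> i \<le> int m - 1 - \<lfloor>real m / real r\<rfloor> \<and>
       1 \<le> j \<and> j \<le> int r - 1 - \<lfloor>real r * real_of_int i / real m\<rfloor>) \<longleftrightarrow>
     1 \<le> i \<and> 1 \<le> j \<and> int m * j + int r * i < int m * int r"
proof -
  have "\<lfloor>real m / real r\<rfloor> < int m - i \<longleftrightarrow> real m / real r < real_of_int (int m - i)"
    by (rule floor_less_iff)
  also have "\<dots> \<longleftrightarrow> real_of_int (int m) < real_of_int ((int m - i) * int r)"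
    using assms by (simp add: pos_divide_less_eq)
  finally have 1: "\<lfloor>real m / real r\<rfloor> < int m - i \<longleftrightarrow> int m < (int m - i) * int r"
    unfolding of_int_less_iff .
  have "\<lfloor>real r * real_of_int i / real m\<rfloor> < int r - j \<longleftrightarrow>
      real r * real_of_int i / real m < real_of_int (int r - j)" by (rule floor_less_iff)
  also have "\<dots> \<longleftrightarrow> real_of_int (int r * i) < real_of_int ((int r - j) * int m)"
    using assms by (simp add: pos_divide_less_eq)
  finally have 2: "\<lfloor>real r * real_of_int i / real m\<rfloor> < int r - j \<longleftrightarrow> int r * i < (int r - j) * int m"
    unfolding of_int_less_iff .
  have 3: "int r * i < (int r - j) * int m \<longleftrightarrow> int m * j + int r * i < int m * int r"
    by (auto simp: algebra_simps)
  have 4: "int m < (int m - i) * int r" if "1 \<le> j" "int m * j + int r * i < int m * int r"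
  proof -
    have "int m * 1 \<le> int m * j" using that(1) by (intro mult_left_mono) auto
    then show ?thesis using that(2) by (simp add: algebra_simps)
  qed
  show ?thesis using 1 2 3 4 by linarith
qed

theorem theorem4p3:
  fixes \<iota> :: "'q::{field,finite} alg_closure \<Rightarrow> 'f::field"
    and x y :: 'f
    and f :: "'q poly"
    and \<alpha> :: "nat \<Rightarrow> 'q alg_closure"
    and m r l :: nat
    and K Kx Q_inf P_inf P :: "'f set"
  assumes emb: "\<iota> \<in> ring_hom ring_of_type_algebra ambient"
    and K: "K = range \<iota>"
    and x: "ring.transcendental ambient K x"
    and Kx: "Kx = generate_field ambient (K \<union> {x})"
    and F: "generate_field ambient (K \<union> {x, y}) = UNIV"
    and m: "m \<ge> 2" "\<not> CHAR('q) dvd m"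
    and l: "l > 0"
    and deg: "Polynomial.degree f = r"
    and sep: "rsquarefree (map_poly to_ac f)"
    and roots: "inj_on \<alpha> {1..r}"
      "map_poly to_ac f ^ l = (\<Prod>i=1..r. [:- \<alpha> i, 1:] ^ l)"
    and kummer: "y ^ m = poly (map_poly (\<iota> \<circ> to_ac) f) x ^ l"
    and cop: "coprime m (r * l)"
    and Q_inf: "place K Kx Q_inf" "val Kx Q_inf x < 0"
    and P_inf: "place K UNIV P_inf" "lies_over P_inf Q_inf"
    and P: "place K UNIV P" "P \<noteq> P_inf" "totally_ramified K Kx P"
  shows "map_prod int int ` Gamma_set K P_inf P =
    {(int m * int r - int m * j - int r * i, i + int m * (j - 1)) | i j :: int.
       1 \<le> i \<and> i \<le> int m - 1 - \<lfloor>real m / real r\<rfloor> \<and>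
       1 \<le> j \<and> j \<le> int r - 1 - \<lfloor>real r * real_of_int i / real m\<rfloor>}"
proof -
  have \<iota>: "\<And>a b. \<iota> (a * b) = \<iota> a * \<iota> b" "\<And>a b. \<iota> (a + b) = \<iota> a + \<iota> b" "\<iota> 1 = 1"
    using emb unfolding ambient_ring_hom_iff by blast+
  have \<iota>0: "\<iota> 0 = 0" by (metis \<iota>(2) add.right_neutral add_left_cancel)
  have \<iota>_nz: "\<iota> a \<noteq> 0" if "a \<noteq> 0" for a
    using \<iota>(1)[of a "inverse a"] \<iota>(3) that by auto
  have "p = 0" if "poly (map_poly \<iota> p) x = 0" for p
  proof -
    have "map_poly \<iota> p \<in> poly_over K" unfolding poly_over_def K by (auto simp: coeff_map_poly \<iota>0)
    then have "map_poly \<iota> p = 0" using transcendental_poly[OF x] that by blast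
    then show "p = 0" using \<iota>_nz by (subst (asm) map_poly_eq_0_iff) (auto simp: \<iota>0)
  qed
  then interpret R: rational_function_field \<iota> x by unfold_locales (use \<iota> in auto)
  have RK: "R.K = K" unfolding K R.K_def ..
  have RL: "R.L = Kx" unfolding Kx R.generate_field_eq_L[symmetric] RK ..
  obtain Q where Q: "place K Kx Q" "Q \<subseteq> P"
      "\<And>P'. place K UNIV P' \<Longrightarrow> Q \<subseteq> P' \<Longrightarrow> P' = P"
      "ring.dimension ambient (ramification_index Kx P Q) Kx UNIV"
    using P(3) unfolding totally_ramified_def lies_over_def by blast
  interpret F: function_field \<iota> x "ramification_index Kx P Q"
    by unfold_locales (use Q(4) RL in simp)
  define g where "g = (\<Prod>i=1..r. [:- \<alpha> i, 1:])"
  have r0: "r \<noteq> 0"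
  proof
    assume "r = 0"
    then show False using cop m(1) by simp
  qed
  have g0: "g \<noteq> 0" unfolding g_def by simp
  have degg: "Polynomial.degree g = r" unfolding g_def by (simp add: degree_prod_sum_eq)
  have "y ^ m = R.evl x (map_poly to_ac f) ^ l"
    unfolding kummer R.evl_def by (simp add: map_poly_map_poly \<iota>0)
  also have "\<dots> = R.evl x g ^ l"
    unfolding R.evl_power[symmetric] roots(2) g_def prod_power_distrib ..
  finally have y_power: "y ^ m = R.evl x g ^ l" .
  have G0: "R.evl x g \<noteq> 0" using g0 R.evl_x_eq_0_iff by blast
  then have y0: "y \<noteq> 0" using y_power m(1) by (auto simp: power_0_left)
  obtain u v where z: "(y powi u * R.evl x g powi v) ^ m = R.evl x g"
      "(y powi u * R.evl x g powi v) ^ l = y"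
    using root_of_coprime_power[OF y_power _ y0 G0] cop by (metis coprime_mult_right_iff)
  define y1 where "y1 = y powi u * R.evl x g powi v"
  have "of_nat m \<noteq> (0 :: 'q alg_closure)"
    using m(2) by (simp add: of_nat_eq_0_iff_char_dvd)
  then interpret E: kummer_extension \<iota> x "ramification_index Kx P Q" m g y1
  proof (unfold_locales, goal_cases)
    case (3 a)
    then show ?case unfolding g_def using order_prod_linear_distinct[OF _ roots(1)] by simp
  next
    case 4
    then show ?case using cop degg by simp
  next
    case (7 w)
    then show ?case using F.generated_by_root[of y y1 l w] F z(2) unfolding RK y1_def by simp
  qed (use m(1) g0 z(1) in \<open>simp_all add: y1_def\<close>)
  have inf: "place R.K UNIV P_inf" "R.loc None \<in> P_inf"
    using P_inf R.place_L_pole_of_x[of Q_inf] Q_inf unfolding RK RL lies_over_def by auto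
  have PP: "place R.K UNIV P" using P(1) RK by simp
  obtain c where c: "R.loc c \<in> P" using F.ex_loc_in_place[OF PP] by blast
  have "c \<noteq> None" using E.ramified_place_unique[OF PP _ inf E.coprime_infinity] c P(2) by auto
  then obtain a where ca: "R.loc (Some a) \<in> P" using c by auto
  have QL: "Q \<subseteq> R.L"
    using Q(1) unfolding RL place_def valuation_ring_def by blast
  have root: "poly g a = 0"
    using E.unramified_place_not_unique[OF PP ca _ QL Q(2)] Q(3) unfolding RK by blast
  have Gamma: "Gamma_set K P_inf P =
      {(m * r - m * j - r * i, i + m * (j - 1)) | i j. i \<ge> 1 \<and> j \<ge> 1 \<and> m * j + r * i < m * r}"
    using E.Gamma_set_eq[OF inf PP ca root] unfolding RK degg .
  have "m > 0" "r > 0" using m(1) r0 by auto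
  note range = index_range_iff[OF this]
  show ?thesis unfolding range Gamma
  proof (intro equalityI subsetI)
    fix s assume "s \<in> map_prod int int `
      {(m * r - m * j - r * i, i + m * (j - 1)) | i j. i \<ge> 1 \<and> j \<ge> 1 \<and> m * j + r * i < m * r}"
    then obtain i j where ij: "i \<ge> 1" "j \<ge> 1" "m * j + r * i < m * r"
      "s = (int (m * r - m * j - r * i), int (i + m * (j - 1)))" by auto
    have "int (m * j + r * i) < int (m * r)" using ij(3) by (simp only: of_nat_less_iff)
    moreover have "s = (int m * int r - int m * int j - int r * int i, int i + int m * (int j - 1))"
      using ij by (simp add: of_nat_diff)
    ultimately show "s \<in> {(int m * int r - int m * j - int r * i, i + int m * (j - 1)) | i j.
        1 \<le> i \<and> 1 \<le> j \<and> int m * j + int r * i < int m * int r}"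
      using ij(1,2) unfolding mem_Collect_eq by (intro exI[of _ "int i"] exI[of _ "int j"]) simp
  next
    fix s assume "s \<in> {(int m * int r - int m * j - int r * i, i + int m * (j - 1)) | i j.
        1 \<le> i \<and> 1 \<le> j \<and> int m * j + int r * i < int m * int r}"
    then obtain i j where ij: "1 \<le> i" "1 \<le> j" "int m * j + int r * i < int m * int r"
      "s = (int m * int r - int m * j - int r * i, i + int m * (j - 1))" by blast
    define i' j' where "i' = nat i" and "j' = nat j"
    have i': "int i' = i" "int j' = j" using ij unfolding i'_def j'_def by auto
    have "int (m * j' + r * i') < int (m * r)" using ij(3) i' by simp
    then have lt: "m * j' + r * i' < m * r" by (simp only: of_nat_less_iff)
    have ge: "i' \<ge> 1" "j' \<ge> 1" using ij i' by linarith+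
    have "s = map_prod int int (m * r - m * j' - r * i', i' + m * (j' - 1))"
      unfolding ij(4) i'[symmetric] using lt ge by (simp add: of_nat_diff)
    then show "s \<in> map_prod int int `
      {(m * r - m * j - r * i, i + m * (j - 1)) | i j. i \<ge> 1 \<and> j \<ge> 1 \<and> m * j + r * i < m * r}"
      using lt ge by blast
  qed
qed

end
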